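(* Let $K\in L_2(\mathbb R)$ be a kernel (satisfying the standing assumptions below) with $S_K>0$, and let $f\in L_2(\mathbb R)$ be a probability density. (i) (Smooth case) If for some integer $k\ge1$, $f$ has a $k$-th derivative $f^{(k)}\in L_1\cap L_2$, then the sequence $n^{2k/(2k+1)}\Phi(n,f,K)$, $n\ge1$, is bounded. (ii) (Supersmooth case) If for some $\alpha>0$ and $\gamma>0$ the integral $I_{\alpha,\gamma}(f)=\int_{\mathbb R} e^{\gamma|t|^\alpha}|\varphi_f(t)|^2dt$ is finite, then the sequence $\frac{n}{(\log n)^{1/\alpha}}\Phi(n,f,K)$, $n\ge2$, is bounded.
   Context: A kernel is an integrable function $K:\mathbb R\to\mathbb R$ with $\int K=1$; standing assumptions: $K$ is bounded, continuous at $0$, and $\int K^2<2K(0)$. For a sample $X_1,\dots,X_n$ i.i.d. with density $f$, bandwidth $h>0$, $f_{n,K,h}(x)=\frac1n\sum_{i=1}^n K_h(x-X_i)$ with $K_h(x)=K(x/h)/h$. $\mathrm{MISE}_f(f_{n,K,h})=E_f\int (f_{n,K,h}-f)^2$, and $\Phi(n,f,K)=\min_{h>0}\mathrm{MISE}_f(f_{n,K,h})$. $\varphi_K(t)=\int e^{itx}K(x)dx$, $\varphi_f(t)=\int e^{itx}f(x)dx$. $S_K=\inf\{t\ge0: |\varphi_K(t)-1|\ne0\}$, i.e. the largest $r$ such that $\varphi_K\equiv1$ on $[0,r]$. *)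

theory Defs
  imports "HOL-Probability.Probability"
begin

definition is_kernel :: "(real \<Rightarrow> real) \<Rightarrow> bool" where
  "is_kernel K \<longleftrightarrow> integrable lborel K \<and> (\<integral>x. K x \<partial>lborel) = 1
     \<and> bounded (range K) \<and> isCont K 0
     \<and> (\<integral>x. (K x)\<^sup>2 \<partial>lborel) < 2 * K 0"

definition is_density :: "(real \<Rightarrow> real) \<Rightarrow> bool" where
  "is_density f \<longleftrightarrow> f \<in> borel_measurable borel \<and> (\<forall>x. 0 \<le> f x)
     \<and> integrable lborel f \<and> (\<integral>x. f x \<partial>lborel) = 1"

definition square_integrable :: "(real \<Rightarrow> real) \<Rightarrow> bool" where
  "square_integrable g \<longleftrightarrow> g \<in> borel_measurable borel \<and> integrable lborel (\<lambda>x. (g x)\<^sup>2)"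

definition fourier :: "(real \<Rightarrow> real) \<Rightarrow> real \<Rightarrow> complex" where
  "fourier g t = (\<integral>x. cis (t * x) * complex_of_real (g x) \<partial>lborel)"

definition S_K :: "(real \<Rightarrow> real) \<Rightarrow> real" where
  "S_K K = Inf {t. 0 \<le> t \<and> fourier K t - 1 \<noteq> 0}"

definition scaled_kernel :: "(real \<Rightarrow> real) \<Rightarrow> real \<Rightarrow> real \<Rightarrow> real" where
  "scaled_kernel K h x = K (x / h) / h"

definition kde :: "nat \<Rightarrow> (real \<Rightarrow> real) \<Rightarrow> real \<Rightarrow> (nat \<Rightarrow> real) \<Rightarrow> real \<Rightarrow> real" where
  "kde n K h X x = (\<Sum>i<n. scaled_kernel K h (x - X i)) / real n"

definition sample_law :: "nat \<Rightarrow> (real \<Rightarrow> real) \<Rightarrow> (nat \<Rightarrow> real) measure" where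
  "sample_law n f = (\<Pi>\<^sub>M i\<in>{..<n}. density lborel (\<lambda>x. ennreal (f x)))"

definition MISE :: "nat \<Rightarrow> (real \<Rightarrow> real) \<Rightarrow> (real \<Rightarrow> real) \<Rightarrow> real \<Rightarrow> ennreal" where
  "MISE n f K h = (\<integral>\<^sup>+ X. (\<integral>\<^sup>+ x. ennreal ((kde n K h X x - f x)\<^sup>2) \<partial>lborel) \<partial>sample_law n f)"

definition Phi :: "nat \<Rightarrow> (real \<Rightarrow> real) \<Rightarrow> (real \<Rightarrow> real) \<Rightarrow> ennreal" where
  "Phi n f K = (INF h\<in>{0<..}. MISE n f K h)"

text \<open>g 0 = f a.e., each g j (j<k) is absolutely continuous with derivative g (j+1),
  i.e. g (k-1) is absolutely continuous and g k is the k-th derivative of f.\<close>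
definition has_kth_derivative :: "nat \<Rightarrow> (real \<Rightarrow> real) \<Rightarrow> (real \<Rightarrow> real) \<Rightarrow> bool" where
  "has_kth_derivative k f d \<longleftrightarrow> (\<exists>g :: nat \<Rightarrow> real \<Rightarrow> real.
     (AE x in lborel. f x = g 0 x) \<and> g k = d \<and>
     (\<forall>j<k. \<forall>a b. a \<le> b \<longrightarrow> set_integrable lborel {a..b} (g (Suc j))) \<and>
     (\<forall>j<k. \<forall>x. g j x = g j 0 + (LBINT t=0..x. g (Suc j) t)))"

end

theory Submission
  imports Defs
begin

text \<open>
  The variance part of the MISE is at most \<open>\<integral>K\<^sup>2 / (n h)\<close>. By Plancherel the squared bias is
  \<open>(2\<pi>)\<^sup>-\<^sup>1 \<integral>\<bar>\<phi>\<^sub>K(h t) - 1\<bar>\<^sup>2 \<bar>\<phi>\<^sub>f(t)\<bar>\<^sup>2 dt\<close>, whose integrand vanishes for \<open>\<bar>t\<bar> < S\<^sub>K / h\<close>,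
  so it is controlled by the tail of \<open>\<phi>\<^sub>f\<close>. This tail is \<open>O(h\<^sup>2\<^sup>k)\<close> in the smooth case, where
  \<open>h = n powr (-1 / (2 k + 1))\<close> balances both terms, and \<open>O(exp (-\<gamma> (S\<^sub>K / h) powr \<alpha>))\<close> in the
  supersmooth case, where \<open>h = S\<^sub>K (\<gamma> / ln n) powr (1 / \<alpha>)\<close> makes it \<open>O(1 / n)\<close>.

  Only two one-sided Plancherel inequalities are needed, both for integrable functions and with
  values in \<open>[0, \<infinity>]\<close>; they follow from a Gaussian-regularised identity by Fatou's lemma.
  The intermediate derivatives of \<open>f\<close> are not assumed integrable, so instead of their Fourier
  transforms the \<open>k\<close>-th forward difference of \<open>f\<close> with a step tending to 0 is used.
\<close>

subsection \<open>Translation continuity in \<open>L\<^sup>1\<close>\<close>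

text \<open>\<open>Phi\<close> is an infimum over bandwidths, so one good \<open>h\<close> for each
  \<open>n\<close> suffices and only upper bounds are needed. This is why two inequalities can
  replace Plancherel's theorem: the bias estimate goes from the transform back to the function,
  while decay of the transform of \<open>f\<close> is extracted from its derivative in the other
  direction. Allowing the value infinity lets both hold before anything is known to lie in L^2. The
  backward inequality must recover a function almost everywhere from its Gaussian averages. These
  converge in L^1 because translation is continuous there, which is what the translation lemmas are
  for. A k-th difference with step \<open>u\<close> multiplies the transform by (exp(-itu) - 1)^k,
  whose modulus divided by u^k tends to |t|^k, while the L^2 norm of the difference is at most u^k
  times that of the k-th derivative. Fatou turns this into the weight |t|^(2k). In the supersmooth
  case the bias is of lower order than the variance, which alone produces the power of the
  logarithm.\<close>

lemma integrable_translate: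
  fixes g :: "real \<Rightarrow> real"
  assumes "integrable lborel g"
  shows "integrable lborel (\<lambda>x. g (x + u))"
  using lborel_integrable_real_affine[OF assms, of 1 u] by (simp add: add.commute)

lemma integral_translate:
  fixes g :: "real \<Rightarrow> real"
  shows "(\<integral>x. g (x + u) \<partial>lborel) = (\<integral>x. g x \<partial>lborel)"
  using lborel_integral_real_affine[of 1 g u] by (simp add: add.commute)

text \<open>\<open>g\<close> is compared with \<open>g'\<close> both at x and at x + u; translation
  invariance makes the two errors equal, hence the factor 2.\<close>

lemma integral_translate_abs_diff_le:
  fixes g g' :: "real \<Rightarrow> real"
  assumes g: "integrable lborel g" and g': "integrable lborel g'"
  shows "(\<integral>x. \<bar>g (x + u) - g x\<bar> \<partial>lborel)
    \<le> (\<integral>x. \<bar>g' (x + u) - g' x\<bar> \<partial>lborel) + 2 * (\<integral>x. \<bar>g x - g' x\<bar> \<partial>lborel)"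
proof -
  note [intro] = g g' integrable_translate
  have "(\<integral>x. \<bar>g (x + u) - g x\<bar> \<partial>lborel)
    \<le> (\<integral>x. \<bar>g (x + u) - g' (x + u)\<bar> + \<bar>g' (x + u) - g' x\<bar> + \<bar>g x - g' x\<bar> \<partial>lborel)"
    by (rule integral_mono) (auto intro!: Bochner_Integration.integrable_add integrable_abs Bochner_Integration.integrable_diff)
  also have "\<dots> = (\<integral>x. \<bar>g (x + u) - g' (x + u)\<bar> \<partial>lborel) + (\<integral>x. \<bar>g' (x + u) - g' x\<bar> \<partial>lborel)
      + (\<integral>x. \<bar>g x - g' x\<bar> \<partial>lborel)"
    by (subst Bochner_Integration.integral_add Bochner_Integration.integral_add;
        auto intro!: Bochner_Integration.integrable_add integrable_abs Bochner_Integration.integrable_diff)+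
  also have "(\<integral>x. \<bar>g (x + u) - g' (x + u)\<bar> \<partial>lborel) = (\<integral>x. \<bar>g x - g' x\<bar> \<partial>lborel)"
    by (rule integral_translate)
  finally show ?thesis by simp
qed

text \<open>The property is closed under L^1 approximation. This is used twice: to pass from open to
  measurable sets and in the limit step of the induction over integrable functions.\<close>

lemma translation_tendsto_L1_approx:
  fixes g :: "real \<Rightarrow> real" and u :: "nat \<Rightarrow> real"
  assumes g: "integrable lborel g"
    and approx: "\<And>e. e > 0 \<Longrightarrow> \<exists>g'. integrable lborel g' \<and> (\<integral>x. \<bar>g x - g' x\<bar> \<partial>lborel) < e \<and>
      (\<lambda>j. \<integral>x. \<bar>g' (x + u j) - g' x\<bar> \<partial>lborel) \<longlonglongrightarrow> 0"
  shows "(\<lambda>j. \<integral>x. \<bar>g (x + u j) - g x\<bar> \<partial>lborel) \<longlonglongrightarrow> 0"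
proof (rule order_tendstoI)
  fix e :: real assume "e > 0"
  \<comment> \<open>A quarter of \<open>e\<close> is needed because the approximation error enters
    twice, leaving e/2 for the translates of \<open>g'\<close>.\<close>
  then obtain g' where g': "integrable lborel g'" "(\<integral>x. \<bar>g x - g' x\<bar> \<partial>lborel) < e / 4"
    and lim: "(\<lambda>j. \<integral>x. \<bar>g' (x + u j) - g' x\<bar> \<partial>lborel) \<longlonglongrightarrow> 0"
    using approx[of "e/4"] by auto
  have "\<forall>\<^sub>F j in sequentially. (\<integral>x. \<bar>g' (x + u j) - g' x\<bar> \<partial>lborel) < e / 2"
    using order_tendstoD(2)[OF lim, of "e/2"] \<open>e > 0\<close> by simp
  then show "\<forall>\<^sub>F j in sequentially. (\<integral>x. \<bar>g (x + u j) - g x\<bar> \<partial>lborel) < e"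
  proof eventually_elim
    case (elim j)
    have "2 * (\<integral>x. \<bar>g x - g' x\<bar> \<partial>lborel) < e / 2" using g'(2) by simp
    with elim integral_translate_abs_diff_le[OF g g'(1), of "u j"] show ?case by linarith
  qed
next
  fix e :: real assume "e < 0"
  then show "\<forall>\<^sub>F j in sequentially. e < (\<integral>x. \<bar>g (x + u j) - g x\<bar> \<partial>lborel)"
    by (intro always_eventually allI) (rule less_le_trans, assumption, rule integral_nonneg_AE, simp)
qed

text \<open>
  Both indicators have the same integral, so the \<open>L\<^sup>1\<close> distance is twice the integral of the positive
  part of the difference; that part tends to 0 pointwise because \<open>U\<close> is open.
\<close>
lemma translation_tendsto_L1_open:
  fixes u :: "nat \<Rightarrow> real"
  assumes U: "open U" "emeasure lborel U < \<infinity>" and u: "u \<longlonglongrightarrow> 0"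
  shows "(\<lambda>j. \<integral>x. \<bar>indicator U (x + u j) - indicat_real U x\<bar> \<partial>lborel) \<longlonglongrightarrow> 0"
proof -
  have Um[measurable]: "U \<in> sets borel" using U by auto
  have int: "integrable lborel (indicat_real U)" using U by simp
  let ?p = "\<lambda>j x. max 0 (indicat_real U x - indicator U (x + u j))"
  have "(\<lambda>j. \<integral>x. ?p j x \<partial>lborel) \<longlonglongrightarrow> (\<integral>x. 0 \<partial>(lborel :: real measure))"
  proof (rule integral_dominated_convergence[where w = "indicat_real U"])
    show "AE x in lborel. (\<lambda>j. ?p j x) \<longlonglongrightarrow> 0"
    proof (rule AE_I2, rule tendsto_eventually)
      fix x :: real
      show "\<forall>\<^sub>F j in sequentially. ?p j x = 0"
      proof (cases "x \<in> U")
        case True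
        have "(\<lambda>j. x + u j) \<longlonglongrightarrow> x" using tendsto_add[OF tendsto_const u] by simp
        from topological_tendstoD[OF this \<open>open U\<close> True] show ?thesis
          by eventually_elim (auto simp: True)
      qed (auto simp: indicator_def)
    qed
    show "AE x in lborel. norm (?p j x) \<le> indicat_real U x" for j
      by (auto simp: indicator_def)
  qed (use int in auto)
  then have "(\<lambda>j. 2 * (\<integral>x. ?p j x \<partial>lborel)) \<longlonglongrightarrow> 0" by (auto intro: tendsto_mult_right_zero)
  moreover have "(\<integral>x. \<bar>indicator U (x + u j) - indicat_real U x\<bar> \<partial>lborel) = 2 * (\<integral>x. ?p j x \<partial>lborel)" for j
  proof -
    have i2: "integrable lborel (\<lambda>x. indicat_real U (x + u j))" by (rule integrable_translate[OF int])
    have "(\<integral>x. \<bar>indicator U (x + u j) - indicat_real U x\<bar> \<partial>lborel)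
      = (\<integral>x. 2 * ?p j x - (indicat_real U x - indicator U (x + u j)) \<partial>lborel)"
      by (rule Bochner_Integration.integral_cong) (auto simp: max_def abs_if)
    also have "\<dots> = 2 * (\<integral>x. ?p j x \<partial>lborel) - ((\<integral>x. indicat_real U x \<partial>lborel) - (\<integral>x. indicat_real U (x + u j) \<partial>lborel))"
      using int i2 by (subst Bochner_Integration.integral_diff; auto)
    also have "(\<integral>x. indicat_real U (x + u j) \<partial>lborel) = (\<integral>x. indicat_real U x \<partial>lborel)"
      by (rule integral_translate)
    finally show ?thesis by simp
  qed
  ultimately show ?thesis by simp
qed

text \<open>Induction over integrable functions: outer regularity reduces indicators to those of
  open sets, sums follow from the triangle inequality, and limits from the closure property.\<close>

lemma translation_tendsto_L1:
  fixes g :: "real \<Rightarrow> real" and u :: "nat \<Rightarrow> real"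
  assumes g: "integrable lborel g" and u: "u \<longlonglongrightarrow> 0"
  shows "(\<lambda>j. \<integral>x. \<bar>g (x + u j) - g x\<bar> \<partial>lborel) \<longlonglongrightarrow> 0"
  using g
proof (induction rule: integrable_induct)
  case (base A c)
  have [measurable]: "A \<in> sets borel" and fin: "emeasure lborel A < \<infinity>" using base by auto
  have "(\<lambda>j. \<integral>x. \<bar>indicator A (x + u j) - indicat_real A x\<bar> \<partial>lborel) \<longlonglongrightarrow> 0"
  proof (rule translation_tendsto_L1_approx)
    show "integrable lborel (indicat_real A)" using fin by simp
    fix e :: real assume e: "e > 0"
    obtain U where U: "open U" "A \<subseteq> U" and small: "emeasure lborel (U - A) < e"
      using outer_regular_lborel[OF _ e, of A] by auto
    have [measurable]: "U \<in> sets borel" using U by auto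
    have "emeasure lborel U = emeasure lborel A + emeasure lborel (U - A)"
      using U by (subst plus_emeasure) (auto simp: Un_absorb1)
    also have "\<dots> < \<infinity>" using fin small by (auto simp: less_top[symmetric] top_unique)
    finally have finU: "emeasure lborel U < \<infinity>" .
    have "(\<integral>x. \<bar>indicat_real A x - indicat_real U x\<bar> \<partial>lborel) = (\<integral>x. indicat_real (U - A) x \<partial>lborel)"
      using U by (intro Bochner_Integration.integral_cong) (auto simp: indicator_def)
    also have "\<dots> = measure lborel (U - A)" by simp
    also have "\<dots> < e" using small e by (simp add: measure_def ennreal_less_iff) 
        (metis enn2real_less_iff ennreal_enn2real_if ennreal_less_top order_less_trans)
    finally show "\<exists>g'. integrable lborel g' \<and> (\<integral>x. \<bar>indicat_real A x - g' x\<bar> \<partial>lborel) < e \<and>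
      (\<lambda>j. \<integral>x. \<bar>g' (x + u j) - g' x\<bar> \<partial>lborel) \<longlonglongrightarrow> 0"
      using translation_tendsto_L1_open[OF U(1) finU u] finU by (intro exI[of _ "indicat_real U"]) auto
  qed
  then have "(\<lambda>j. (\<integral>x. \<bar>indicator A (x + u j) - indicat_real A x\<bar> \<partial>lborel) * \<bar>c\<bar>) \<longlonglongrightarrow> 0"
    by (rule tendsto_mult_left_zero)
  then show ?case by (simp add: left_diff_distrib[symmetric] abs_mult)
next
  case (add f g)
  have "(\<lambda>j. (\<integral>x. \<bar>f (x + u j) - f x\<bar> \<partial>lborel) + (\<integral>x. \<bar>g (x + u j) - g x\<bar> \<partial>lborel)) \<longlonglongrightarrow> 0"
    using tendsto_add[OF add.IH] by simp
  then show ?case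
  proof (rule tendsto_sandwich[OF _ _ tendsto_const, rotated 2])
    show "\<forall>\<^sub>F j in sequentially. (\<integral>x. \<bar>f (x + u j) + g (x + u j) - (f x + g x)\<bar> \<partial>lborel)
       \<le> (\<integral>x. \<bar>f (x + u j) - f x\<bar> \<partial>lborel) + (\<integral>x. \<bar>g (x + u j) - g x\<bar> \<partial>lborel)"
      using add.hyps
      by (intro always_eventually allI, subst Bochner_Integration.integral_add[symmetric])
         (auto intro!: integral_mono integrable_abs Bochner_Integration.integrable_add Bochner_Integration.integrable_diff integrable_translate)
  qed auto
next
  case (lim f s)
  show ?case
  proof (rule translation_tendsto_L1_approx)
    fix e :: real assume e: "e > 0"
    have "(\<lambda>i. \<integral>x. \<bar>f x - s i x\<bar> \<partial>lborel) \<longlonglongrightarrow> (\<integral>x. 0 \<partial>(lborel :: real measure))"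
    \<comment> \<open>The approximants of the induction satisfy |s_i| <= 2 |f|, hence |f - s_i| <= 3
      |f|.\<close>
    proof (rule integral_dominated_convergence[where w = "\<lambda>x. 3 * \<bar>f x\<bar>"])
      show "AE x in lborel. (\<lambda>i. \<bar>f x - s i x\<bar>) \<longlonglongrightarrow> 0"
        using lim.hyps(2) by (intro AE_I2 tendsto_rabs_zero) (auto intro!: tendsto_eq_intros)
      show "AE x in lborel. norm \<bar>f x - s i x\<bar> \<le> 3 * \<bar>f x\<bar>" for i
      proof (rule AE_I2)
        fix x :: real
        show "norm \<bar>f x - s i x\<bar> \<le> 3 * \<bar>f x\<bar>" using lim.hyps(3)[of x i] by simp
      qed
      show "(\<lambda>x. \<bar>f x - s i x\<bar>) \<in> borel_measurable lborel" for i
        using lim.hyps(1)[of i] lim.hyps(4) by measurable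
    qed (use lim.hyps(4) in auto)
    then have "\<forall>\<^sub>F i in sequentially. (\<integral>x. \<bar>f x - s i x\<bar> \<partial>lborel) < e"
      using e by (auto dest: order_tendstoD)
    then obtain i where "(\<integral>x. \<bar>f x - s i x\<bar> \<partial>lborel) < e"
      by (auto simp: eventually_sequentially)
    then show "\<exists>g'. integrable lborel g' \<and> (\<integral>x. \<bar>f x - g' x\<bar> \<partial>lborel) < e \<and>
      (\<lambda>j. \<integral>x. \<bar>g' (x + u j) - g' x\<bar> \<partial>lborel) \<longlonglongrightarrow> 0"
      using lim.hyps(1)[of i] lim.IH[of i] by (intro exI[of _ "s i"]) auto
  qed (fact lim.hyps(4))
qed

subsection \<open>Gaussian regularisation\<close>

text \<open>For integrable arguments the integrand may fail to be integrable on a null set of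
  \<open>x\<close>; there the value is 0 by the Bochner convention.\<close>

definition conv :: "(real \<Rightarrow> real) \<Rightarrow> (real \<Rightarrow> real) \<Rightarrow> real \<Rightarrow> real" where
  "conv h g x = (\<integral>y. h (x - y) * g y \<partial>lborel)"

lemma borel_measurable_conv[measurable]:
  assumes [measurable]: "h \<in> borel_measurable borel" "g \<in> borel_measurable borel"
  shows "conv h g \<in> borel_measurable borel"
  unfolding conv_def[abs_def] by measurable

lemma integral_reflect_translate:
  fixes h :: "real \<Rightarrow> real"
  shows "(\<integral>x. h (u - x) \<partial>lborel) = (\<integral>x. h x \<partial>lborel)"
  using lborel_integral_real_affine[of "-1" h u] by simp

text \<open>Integrating over \<open>x\<close> first, each fibre is a translate of \<open>h\<close>
  times a constant, so it is integrable for every \<open>y\<close> with norm proportional to |g y|.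
  The variables are swapped only at the end.\<close>

lemma integrable_conv_pair:
  fixes h g :: "real \<Rightarrow> real"
  assumes h: "integrable lborel h" and g: "integrable lborel g"
  shows "integrable (lborel \<Otimes>\<^sub>M lborel) (\<lambda>(x, y). h (x - y) * g y)"
proof -
  have [measurable]: "h \<in> borel_measurable borel" "g \<in> borel_measurable borel" using h g by auto
  have "integrable (lborel \<Otimes>\<^sub>M lborel) (\<lambda>(y, x). h (x - y) * g y)"
  proof (rule lborel_pair.Fubini_integrable)
    have "(\<integral>x. \<bar>h (x - y)\<bar> \<partial>lborel) = (\<integral>x. \<bar>h x\<bar> \<partial>lborel)" for y
      using integral_translate[of "\<lambda>x. \<bar>h x\<bar>" "-y"] by simp
    then show "integrable lborel (\<lambda>y. \<integral>x. norm ((\<lambda>(y, x). h (x - y) * g y) (y, x)) \<partial>lborel)"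
      using g by (simp add: abs_mult)
    show "AE y in lborel. integrable lborel (\<lambda>x. (\<lambda>(y, x). h (x - y) * g y) (y, x))"
      using integrable_translate[OF h, of "- _"] by (auto intro!: AE_I2)
  qed measurable
  from lborel_pair.integrable_product_swap[OF this] show ?thesis
    by (simp add: case_prod_beta)
qed

lemma integrable_conv:
  assumes "integrable lborel h" "integrable lborel g"
  shows "integrable lborel (conv h g)"
  using lborel_pair.integrable_fst'[OF integrable_conv_pair[OF assms]] by (simp add: conv_def[abs_def])

lemma integrable_mult_bounded:
  fixes a b :: "'a \<Rightarrow> real"
  assumes "integrable M a" "b \<in> borel_measurable M" "\<And>x. \<bar>b x\<bar> \<le> B"
  shows "integrable M (\<lambda>x. a x * b x)"
proof (rule Bochner_Integration.integrable_bound)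
  show "integrable M (\<lambda>x. B * \<bar>a x\<bar>)" using assms(1) by auto
  have "\<bar>b x\<bar> \<le> \<bar>B\<bar>" for x using assms(3)[of x] by simp
  then show "AE x in M. norm (a x * b x) \<le> norm (B * \<bar>a x\<bar>)"
    by (auto simp: abs_mult mult.commute[of "\<bar>B\<bar>"] intro!: mult_left_mono)
  show "(\<lambda>x. a x * b x) \<in> borel_measurable M" using assms(1,2) by measurable
qed

lemma abs_integral_mult_bounded_le:
  fixes a b :: "'a \<Rightarrow> real"
  assumes "integrable M a" "b \<in> borel_measurable M" "\<And>x. \<bar>b x\<bar> \<le> B"
  shows "\<bar>\<integral>x. a x * b x \<partial>M\<bar> \<le> (\<integral>x. \<bar>a x\<bar> \<partial>M) * B"
proof -
  have "\<bar>\<integral>x. a x * b x \<partial>M\<bar> \<le> (\<integral>x. \<bar>a x * b x\<bar> \<partial>M)" by (rule integral_abs_bound)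
  also have "\<dots> \<le> (\<integral>x. \<bar>a x\<bar> * B \<partial>M)"
    using assms by (intro integral_mono integrable_abs integrable_mult_bounded)
      (auto simp: abs_mult intro!: mult_left_mono)
  finally show ?thesis by simp
qed

text \<open>The bound on \<open>C\<close> makes the product integrable on the plane. Cosine and
  Gaussian kernels both enter the Plancherel argument through this one interchange.\<close>

lemma Fubini_bounded_kernel:
  fixes a b :: "real \<Rightarrow> real" and C :: "real \<Rightarrow> real \<Rightarrow> real"
  assumes a: "integrable lborel a" and b: "integrable lborel b"
    and C: "(\<lambda>(x, y). C x y) \<in> borel_measurable (borel \<Otimes>\<^sub>M borel)" and B: "\<And>x y. \<bar>C x y\<bar> \<le> B"
  shows "(\<integral>x. a x * (\<integral>y. b y * C x y \<partial>lborel) \<partial>lborel) = (\<integral>y. b y * (\<integral>x. a x * C x y \<partial>lborel) \<partial>lborel)"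
proof -
  have [measurable]: "a \<in> borel_measurable borel" "b \<in> borel_measurable borel" using a b by auto
  note [measurable] = C
  have int: "integrable (lborel \<Otimes>\<^sub>M lborel) (\<lambda>(x, y). a x * (b y * C x y))"
  proof (rule lborel_pair.Fubini_integrable)
    have Cx: "integrable lborel (\<lambda>y. b y * C x y)" for x
      by (rule integrable_mult_bounded[OF b _ B]) measurable
    have "(\<integral>y. \<bar>b y\<bar> * \<bar>C x y\<bar> \<partial>lborel) \<le> (\<integral>y. \<bar>b y\<bar> \<partial>lborel) * B" for x
      using abs_integral_mult_bounded_le[of lborel "\<lambda>y. \<bar>b y\<bar>" "\<lambda>y. \<bar>C x y\<bar>" B] b B by simp
    then have "integrable lborel (\<lambda>x. \<bar>a x\<bar> * (\<integral>y. \<bar>b y\<bar> * \<bar>C x y\<bar> \<partial>lborel))"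
      using a by (intro integrable_mult_bounded[where B = "(\<integral>y. \<bar>b y\<bar> \<partial>lborel) * B"]) (auto simp: abs_of_nonneg)
    then show "integrable lborel (\<lambda>x. \<integral>y. norm ((\<lambda>(x, y). a x * (b y * C x y)) (x, y)) \<partial>lborel)"
      by (simp add: abs_mult)
    show "AE x in lborel. integrable lborel (\<lambda>y. (\<lambda>(x, y). a x * (b y * C x y)) (x, y))"
      using Cx by auto
  qed measurable
  have "(\<integral>x. a x * (\<integral>y. b y * C x y \<partial>lborel) \<partial>lborel) = (\<integral>x. (\<integral>y. a x * (b y * C x y) \<partial>lborel) \<partial>lborel)" by simp
  also have "\<dots> = (\<integral>y. (\<integral>x. a x * (b y * C x y) \<partial>lborel) \<partial>lborel)"
    using lborel_pair.Fubini_integral[OF int] by simp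
  also have "\<dots> = (\<integral>y. b y * (\<integral>x. a x * C x y \<partial>lborel) \<partial>lborel)"
    unfolding integral_mult_right_zero[symmetric] by (simp only: mult.left_commute)
  finally show ?thesis .
qed

text \<open>After rescaling by the deviation this is the real part of the characteristic function of
  the standard normal law.\<close>

lemma integral_normal_density_cos:
  assumes "\<tau> > 0"
  shows "(\<integral>t. normal_density 0 \<tau> t * cos (t * u) \<partial>lborel) = exp (- (\<tau> * u)\<^sup>2 / 2)"
proof -
  have "(\<integral>t. normal_density 0 \<tau> t * cos (t * u) \<partial>lborel)
      = \<tau> * (\<integral>t. normal_density 0 \<tau> (\<tau> * t) * cos (\<tau> * t * u) \<partial>lborel)"
    using lborel_integral_real_affine[of \<tau> "\<lambda>t. normal_density 0 \<tau> t * cos (t * u)" 0] assms by simp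
  also have "\<dots> = (\<integral>t. std_normal_density t * cos ((\<tau> * u) * t) \<partial>lborel)"
    unfolding integral_mult_right_zero[symmetric] using assms
    by (intro Bochner_Integration.integral_cong refl)
       (simp add: normal_density_def power_mult_distrib real_sqrt_mult field_simps)
  also have "\<dots> = (\<integral>t. cos ((\<tau> * u) * t) \<partial>std_normal_distribution)"
    by (subst integral_density) auto
  also have "\<dots> = Re (char std_normal_distribution (\<tau> * u))"
  proof -
    interpret real_distribution std_normal_distribution by (rule real_dist_normal_dist)
    show ?thesis unfolding char_def
      by (subst integral_Re[symmetric]) (auto intro!: integrable_iexp simp: Re_exp)
  qed
  also have "\<dots> = exp (- (\<tau> * u)\<^sup>2 / 2)" by (simp add: char_std_normal_distribution)
  finally show ?thesis .
qed

lemma normal_density_le: "s > 0 \<Longrightarrow> \<bar>normal_density 0 s x\<bar> \<le> 1 / (sqrt (2 * pi) * s)"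
  by (simp add: normal_density_def real_sqrt_mult field_simps)

section \<open>Fourier transforms of integrable functions and the Gaussian-weighted
  identities\<close>

lemma integrable_fourier:
  fixes g :: "real \<Rightarrow> real"
  assumes "integrable lborel g"
  shows "integrable lborel (\<lambda>x. cis (t * x) * complex_of_real (g x))"
proof (rule Bochner_Integration.integrable_bound[OF assms])
  have [measurable]: "g \<in> borel_measurable borel" using assms by auto
  show "(\<lambda>x. cis (t * x) * complex_of_real (g x)) \<in> borel_measurable lborel"
    unfolding cis_conv_exp by measurable
qed (simp add: norm_mult)

lemma fourier_eq_cos_sin:
  assumes g: "integrable lborel g"
  shows "Re (fourier g t) = (\<integral>x. g x * cos (t * x) \<partial>lborel)"
    and "Im (fourier g t) = (\<integral>x. g x * sin (t * x) \<partial>lborel)"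
  unfolding fourier_def
   apply (subst integral_Re[OF integrable_fourier[OF g], symmetric], simp add: mult.commute)
  apply (subst integral_Im[OF integrable_fourier[OF g], symmetric], simp add: mult.commute)
  done

lemma integrable_mult_cos_sin:
  fixes g :: "real \<Rightarrow> real"
  assumes g: "integrable lborel g"
  shows "integrable lborel (\<lambda>x. g x * cos (t * x))" "integrable lborel (\<lambda>x. g x * sin (t * x))"
  using integrable_Re[OF integrable_fourier[OF g, of t]] integrable_Im[OF integrable_fourier[OF g, of t]]
  by (simp_all add: mult.commute)

lemma borel_measurable_fourier[measurable]:
  assumes g: "integrable lborel g"
  shows "fourier g \<in> borel_measurable borel"
proof -
  have [measurable]: "g \<in> borel_measurable borel" using assms by auto
  show ?thesis unfolding fourier_def[abs_def] cis_conv_exp by measurable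
qed

text \<open>The addition theorem for cos(tx - ty) separates the variables. In this form the squared
  modulus is a real quadratic form in \<open>g\<close> that depends on \<open>t\<close> only through
  a cosine, ready to be integrated against a Gaussian.\<close>

lemma cmod_fourier_squared:
  assumes g: "integrable lborel g"
  shows "(cmod (fourier g t))\<^sup>2 = (\<integral>x. g x * (\<integral>y. g y * cos (t * (x - y)) \<partial>lborel) \<partial>lborel)"
proof -
  let ?c = "\<integral>x. g x * cos (t * x) \<partial>lborel" and ?s = "\<integral>x. g x * sin (t * x) \<partial>lborel"
  have inner: "(\<integral>y. g y * cos (t * (x - y)) \<partial>lborel) = cos (t * x) * ?c + sin (t * x) * ?s" for x
  proof -
    have "(\<integral>y. g y * cos (t * (x - y)) \<partial>lborel)
       = (\<integral>y. cos (t * x) * (g y * cos (t * y)) + sin (t * x) * (g y * sin (t * y)) \<partial>lborel)"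
      by (intro Bochner_Integration.integral_cong refl) (simp add: right_diff_distrib cos_diff algebra_simps)
    then show ?thesis
      by (subst (asm) Bochner_Integration.integral_add) (use integrable_mult_cos_sin[OF g] in auto)
  qed
  have "(\<integral>x. g x * (cos (t * x) * ?c + sin (t * x) * ?s) \<partial>lborel)
      = (\<integral>x. ?c * (g x * cos (t * x)) + ?s * (g x * sin (t * x)) \<partial>lborel)"
    by (intro Bochner_Integration.integral_cong refl) (simp add: algebra_simps)
  also have "\<dots> = ?c * ?c + ?s * ?s"
    by (subst Bochner_Integration.integral_add) (use integrable_mult_cos_sin[OF g] in auto)
  finally show ?thesis unfolding inner cmod_power2 fourier_eq_cos_sin[OF g] by (simp add: power2_eq_square)
qed

lemma cmod_fourier_le:
  assumes g: "integrable lborel g"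
  shows "cmod (fourier g t) \<le> (\<integral>x. \<bar>g x\<bar> \<partial>lborel)"
  unfolding fourier_def
  by (rule order_trans[OF integral_norm_bound]) (simp add: norm_mult)

text \<open>The Gaussian weight makes the triple integral absolutely convergent, so \<open>t\<close>
  can be integrated first; this replaces the cosine by a Gaussian in x - y. The two normalisations
  sqrt(2 pi) / s and sqrt(2 pi) * s multiply to 2 pi.\<close>

lemma nn_integral_fourier_gauss:
  assumes g: "integrable lborel g" and s: "s > 0"
  shows "(\<integral>\<^sup>+t. ennreal ((cmod (fourier g t))\<^sup>2 * exp (- (s * t)\<^sup>2 / 2)) \<partial>lborel)
    = ennreal (2 * pi * (\<integral>x. g x * conv (normal_density 0 s) g x \<partial>lborel))"
proof -
  \<comment> \<open>Widths on the frequency and the space side are reciprocal: exp(-(s t)^2 / 2) is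
    a multiple of the normal density with deviation 1/s.\<close>
  define \<tau> where "\<tau> = 1 / s"
  have \<tau>: "\<tau> > 0" using s by (simp add: \<tau>_def)
  have [measurable]: "g \<in> borel_measurable borel" using g by auto
  note [measurable] = borel_measurable_fourier[OF g]
  define C where "C t x = (\<integral>y. g y * cos (t * (x - y)) \<partial>lborel)" for t x
  have Cm: "(\<lambda>(t, x). C t x) \<in> borel_measurable (borel \<Otimes>\<^sub>M borel)"
    unfolding C_def by measurable
  have Cb: "\<bar>C t x\<bar> \<le> (\<integral>x. \<bar>g x\<bar> \<partial>lborel)" for t x
    using abs_integral_mult_bounded_le[OF g, of "\<lambda>y. cos (t * (x - y))" 1] by (simp add: C_def)
  have w: "exp (- (s * t)\<^sup>2 / 2) = sqrt (2 * pi) * \<tau> * normal_density 0 \<tau> t" for t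
    using s by (simp add: normal_density_def \<tau>_def real_sqrt_mult real_sqrt_divide power_mult_distrib power_divide)
  have w': "exp (- (\<tau> * t)\<^sup>2 / 2) = sqrt (2 * pi) * s * normal_density 0 s t" for t
    using s by (simp add: normal_density_def \<tau>_def real_sqrt_mult field_simps)
  have b2: "\<bar>(cmod (fourier g t))\<^sup>2\<bar> \<le> (\<integral>x. \<bar>g x\<bar> \<partial>lborel)\<^sup>2" for t
    using cmod_fourier_le[OF g, of t] by (simp add: power_mono)
  have int: "integrable lborel (\<lambda>t. normal_density 0 \<tau> t * (cmod (fourier g t))\<^sup>2)"
    by (rule integrable_mult_bounded[OF _ _ b2]) (use \<tau> in auto)
  have "(\<integral>t. normal_density 0 \<tau> t * (cmod (fourier g t))\<^sup>2 \<partial>lborel)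
      = (\<integral>t. normal_density 0 \<tau> t * (\<integral>x. g x * C t x \<partial>lborel) \<partial>lborel)"
    by (simp add: cmod_fourier_squared[OF g] C_def)
  also have "\<dots> = (\<integral>x. g x * (\<integral>t. normal_density 0 \<tau> t * C t x \<partial>lborel) \<partial>lborel)"
    by (rule Fubini_bounded_kernel[OF _ g Cm Cb]) (use \<tau> in auto)
  also have "\<dots> = (\<integral>x. g x * (\<integral>y. g y * exp (- (\<tau> * (x - y))\<^sup>2 / 2) \<partial>lborel) \<partial>lborel)"
  proof -
    have "(\<integral>t. normal_density 0 \<tau> t * C t x \<partial>lborel)
        = (\<integral>y. g y * (\<integral>t. normal_density 0 \<tau> t * cos (t * (x - y)) \<partial>lborel) \<partial>lborel)" for x
      unfolding C_def by (rule Fubini_bounded_kernel[where B = 1, OF _ g]) (use \<tau> in auto)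
    then show ?thesis by (simp only: integral_normal_density_cos[OF \<tau>])
  qed
  also have "\<dots> = sqrt (2 * pi) * s * (\<integral>x. g x * conv (normal_density 0 s) g x \<partial>lborel)"
  proof -
    have "(\<integral>y. g y * exp (- (\<tau> * (x - y))\<^sup>2 / 2) \<partial>lborel) = sqrt (2 * pi) * s * conv (normal_density 0 s) g x" for x
      unfolding w' conv_def integral_mult_right_zero[symmetric]
      by (intro Bochner_Integration.integral_cong refl) simp
    then show ?thesis
      unfolding integral_mult_right_zero[symmetric]
      by (intro Bochner_Integration.integral_cong refl) simp
  qed
  finally have eq: "sqrt (2 * pi) * \<tau> * (\<integral>t. normal_density 0 \<tau> t * (cmod (fourier g t))\<^sup>2 \<partial>lborel)
     = 2 * pi * (\<integral>x. g x * conv (normal_density 0 s) g x \<partial>lborel)"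
    using s by (simp add: \<tau>_def)
  have "(\<integral>\<^sup>+t. ennreal ((cmod (fourier g t))\<^sup>2 * exp (- (s * t)\<^sup>2 / 2)) \<partial>lborel)
     = (\<integral>\<^sup>+t. ennreal (sqrt (2 * pi) * \<tau> * (normal_density 0 \<tau> t * (cmod (fourier g t))\<^sup>2)) \<partial>lborel)"
    unfolding w by (simp add: mult_ac)
  also have "\<dots> = ennreal (\<integral>t. sqrt (2 * pi) * \<tau> * (normal_density 0 \<tau> t * (cmod (fourier g t))\<^sup>2) \<partial>lborel)"
    using int \<tau> by (intro nn_integral_eq_integral) auto
  finally show ?thesis using eq by simp
qed

text \<open>Squaring the smoothed function produces two Gaussians, which merge into one of width
  sqrt 2 * s. The result is again the quadratic form of \<open>nn_integral_fourier_gauss\<close>, so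
  for smoothed functions Plancherel holds exactly.\<close>

lemma nn_integral_conv_gauss_squared:
  assumes g: "integrable lborel g" and s: "s > 0"
  shows "(\<integral>\<^sup>+x. ennreal ((conv (normal_density 0 s) g x)\<^sup>2) \<partial>lborel)
    = ennreal (\<integral>x. g x * conv (normal_density 0 (sqrt 2 * s)) g x \<partial>lborel)"
proof -
  let ?N = "normal_density 0 s" and ?G = "conv (normal_density 0 s) g"
  let ?B = "1 / (sqrt (2 * pi) * s)"
  have [measurable]: "g \<in> borel_measurable borel" using g by auto
  have N: "integrable lborel ?N" using s by simp
  have G: "integrable lborel ?G" by (rule integrable_conv[OF N g])
  have b: "\<bar>?N x\<bar> \<le> ?B" for x using normal_density_le[OF s] .
  have conv_alt: "conv h g x = (\<integral>y. g y * h (x - y) \<partial>lborel)" for h x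
    by (simp add: conv_def mult.commute)
  have Gb: "\<bar>?G x\<bar> \<le> (\<integral>x. \<bar>g x\<bar> \<partial>lborel) * ?B" for x
    unfolding conv_alt by (rule abs_integral_mult_bounded_le[OF g _ b]) measurable
  have NN: "(\<integral>x. ?N (x - y) * ?N (x - z) \<partial>lborel) = normal_density 0 (sqrt 2 * s) (y - z)" for y z
  proof -
    have ev: "?N (- x) = ?N x" for x by (simp add: normal_density_def)
    \<comment> \<open>A shift by \<open>z\<close> and evenness turn the product into a convolution
      of two centred normal densities, whose variances add.\<close>
    have "(\<integral>x. ?N (x - y) * ?N (x - z) \<partial>lborel) = (\<integral>x. ?N ((y - z) - x) * ?N x \<partial>lborel)"
      using integral_translate[of "\<lambda>x. ?N (x - y) * ?N (x - z)" z] ev[of "y - z - _"]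
      by (simp add: algebra_simps)
    also have "\<dots> = enn2real (\<integral>\<^sup>+x. ennreal (?N ((y - z) - x) * ?N x) \<partial>lborel)"
      by (rule integral_eq_nn_integral) auto
    also have "\<dots> = normal_density 0 (sqrt (s\<^sup>2 + s\<^sup>2)) (y - z)"
      using fun_cong[OF conv_normal_density_zero_mean[OF s s], of "y - z"] by simp
    also have "sqrt (s\<^sup>2 + s\<^sup>2) = sqrt 2 * s" using s by (simp add: real_sqrt_mult)
    finally show ?thesis .
  qed
  have "(\<integral>x. (?G x)\<^sup>2 \<partial>lborel) = (\<integral>x. ?G x * (\<integral>y. g y * ?N (x - y) \<partial>lborel) \<partial>lborel)"
    by (simp add: power2_eq_square conv_alt)
  also have "\<dots> = (\<integral>y. g y * (\<integral>x. ?G x * ?N (x - y) \<partial>lborel) \<partial>lborel)"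
    by (rule Fubini_bounded_kernel[OF G g _ b]) measurable
  also have "\<dots> = (\<integral>y. g y * conv (normal_density 0 (sqrt 2 * s)) g y \<partial>lborel)"
  proof -
    have "(\<integral>x. ?G x * ?N (x - y) \<partial>lborel) = (\<integral>x. ?N (x - y) * (\<integral>z. g z * ?N (x - z) \<partial>lborel) \<partial>lborel)" for y
      by (simp add: conv_alt mult.commute)
    also have "\<dots> y = (\<integral>z. g z * (\<integral>x. ?N (x - y) * ?N (x - z) \<partial>lborel) \<partial>lborel)" for y
      using integrable_translate[OF N, of "-y"] by (intro Fubini_bounded_kernel[OF _ g _ b]) auto
    finally show ?thesis by (simp add: NN conv_alt)
  qed
  finally have eq: "(\<integral>x. (?G x)\<^sup>2 \<partial>lborel) = (\<integral>y. g y * conv (normal_density 0 (sqrt 2 * s)) g y \<partial>lborel)" .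
  have "integrable lborel (\<lambda>x. (?G x)\<^sup>2)"
    unfolding power2_eq_square by (rule integrable_mult_bounded[OF G _ Gb]) measurable
  then show ?thesis unfolding eq[symmetric] by (intro nn_integral_eq_integral) auto
qed

subsection \<open>Plancherel inequalities\<close>

text \<open>Fatou's lemma for a bound uniform in \<open>j\<close>; \<open>c\<close> may be infinite,
  so no finiteness has to be settled beforehand.\<close>

lemma nn_integral_le_of_tendsto:
  fixes u :: "nat \<Rightarrow> 'a \<Rightarrow> ennreal"
  assumes "\<And>j. u j \<in> borel_measurable M" and "AE x in M. (\<lambda>j. u j x) \<longlonglongrightarrow> f x"
    and "\<And>j. (\<integral>\<^sup>+x. u j x \<partial>M) \<le> c"
  shows "(\<integral>\<^sup>+x. f x \<partial>M) \<le> c"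
proof -
  have "(\<integral>\<^sup>+x. f x \<partial>M) = (\<integral>\<^sup>+x. liminf (\<lambda>j. u j x) \<partial>M)"
    using assms(2) by (intro nn_integral_cong_AE) (auto simp: lim_imp_Liminf)
  also have "\<dots> \<le> liminf (\<lambda>j. \<integral>\<^sup>+x. u j x \<partial>M)" by (rule nn_integral_liminf) (rule assms(1))
  also have "\<dots> \<le> limsup (\<lambda>j. \<integral>\<^sup>+x. u j x \<partial>M)" by (rule Liminf_le_Limsup) simp
  also have "\<dots> \<le> c" by (rule Limsup_bounded) (simp add: assms(3))
  finally show ?thesis .
qed

text \<open>If \<open>a\<close> is not integrable, its Bochner integral is 0 by convention and the
  bound is trivial. Convolution integrals can thus be estimated without first showing that they
  converge.\<close>

lemma ennreal_abs_integral_le: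
  fixes a :: "'a \<Rightarrow> real"
  assumes "a \<in> borel_measurable M"
  shows "ennreal \<bar>\<integral>x. a x \<partial>M\<bar> \<le> (\<integral>\<^sup>+x. ennreal \<bar>a x\<bar> \<partial>M)"
proof (cases "integrable M a")
  case True
  then show ?thesis using integral_norm_bound_ennreal[of M a] by simp
qed (simp add: not_integrable_integral_eq)

lemma nn_integral_translate:
  fixes F :: "real \<Rightarrow> ennreal"
  assumes [measurable]: "F \<in> borel_measurable borel"
  shows "(\<integral>\<^sup>+x. F (x + u) \<partial>lborel) = (\<integral>\<^sup>+x. F x \<partial>lborel)"
  using nn_integral_real_affine[of F 1 u] by (simp add: add.commute)

lemma nn_integral_reflect_translate:
  fixes F :: "real \<Rightarrow> ennreal"
  assumes [measurable]: "F \<in> borel_measurable borel"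
  shows "(\<integral>\<^sup>+x. F (u - x) \<partial>lborel) = (\<integral>\<^sup>+x. F x \<partial>lborel)"
  using nn_integral_real_affine[of F "-1" u] by simp

lemma nn_integral_normal_density: "s > 0 \<Longrightarrow> (\<integral>\<^sup>+x. ennreal (normal_density m s x) \<partial>lborel) = 1"
  by (subst nn_integral_eq_integral) auto

text \<open>Schur's test: g(x) g(y) is at most the mean of the two squares, and the Gaussian has
  mass 1 in each variable separately, so each square contributes half of the right-hand
  side.\<close>

lemma gauss_form_le:
  assumes g: "integrable lborel g" and s: "s > 0"
  shows "ennreal (\<integral>x. g x * conv (normal_density 0 s) g x \<partial>lborel) \<le> (\<integral>\<^sup>+x. ennreal ((g x)\<^sup>2) \<partial>lborel)"
proof -
  let ?N = "normal_density 0 s"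
  have [measurable]: "g \<in> borel_measurable borel" using g by auto
  have mass: "(\<integral>\<^sup>+x. ennreal (c * ?N (x - y)) \<partial>lborel) = ennreal c" "(\<integral>\<^sup>+x. ennreal (c * ?N (y - x)) \<partial>lborel) = ennreal c"
    if "c \<ge> 0" for c y
    using s that nn_integral_translate[of "\<lambda>x. ennreal (?N x)" "- y"] nn_integral_reflect_translate[of "\<lambda>x. ennreal (?N x)" y]
    by (simp_all add: ennreal_mult nn_integral_cmult nn_integral_normal_density)
  have "ennreal (\<integral>x. g x * conv ?N g x \<partial>lborel) \<le> ennreal \<bar>\<integral>x. g x * conv ?N g x \<partial>lborel\<bar>"
    by (intro ennreal_leI) simp
  also have "\<dots> \<le> (\<integral>\<^sup>+x. ennreal \<bar>g x * conv ?N g x\<bar> \<partial>lborel)"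
    by (rule ennreal_abs_integral_le) measurable
  also have "\<dots> \<le> (\<integral>\<^sup>+x. (\<integral>\<^sup>+y. ennreal ((g x)\<^sup>2 / 2 * ?N (x - y)) + ennreal ((g y)\<^sup>2 / 2 * ?N (x - y)) \<partial>lborel) \<partial>lborel)"
  proof (rule nn_integral_mono)
    fix x
    have "ennreal \<bar>g x * conv ?N g x\<bar> = ennreal \<bar>\<integral>y. g x * (?N (x - y) * g y) \<partial>lborel\<bar>"
      by (simp add: conv_def)
    also have "\<dots> \<le> (\<integral>\<^sup>+y. ennreal \<bar>g x * (?N (x - y) * g y)\<bar> \<partial>lborel)"
      by (rule ennreal_abs_integral_le) measurable
    also have "\<dots> \<le> (\<integral>\<^sup>+y. ennreal ((g x)\<^sup>2 / 2 * ?N (x - y)) + ennreal ((g y)\<^sup>2 / 2 * ?N (x - y)) \<partial>lborel)"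
    proof (rule nn_integral_mono)
      fix y
      have "\<bar>g x\<bar> * \<bar>g y\<bar> \<le> (g x)\<^sup>2 / 2 + (g y)\<^sup>2 / 2"
        using sum_squares_bound[of "\<bar>g x\<bar>" "\<bar>g y\<bar>"] by simp
      then have "\<bar>g x\<bar> * \<bar>g y\<bar> * ?N (x - y) \<le> ((g x)\<^sup>2 / 2 + (g y)\<^sup>2 / 2) * ?N (x - y)"
        by (rule mult_right_mono) simp
      then show "ennreal \<bar>g x * (?N (x - y) * g y)\<bar> \<le> ennreal ((g x)\<^sup>2 / 2 * ?N (x - y)) + ennreal ((g y)\<^sup>2 / 2 * ?N (x - y))"
        by (subst ennreal_plus[symmetric]) (auto intro!: ennreal_leI simp: abs_mult algebra_simps simp del: ennreal_plus)
    qed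
    finally show "ennreal \<bar>g x * conv ?N g x\<bar> \<le> \<dots>" .
  qed
  also have "\<dots> = (\<integral>\<^sup>+x. (\<integral>\<^sup>+y. ennreal ((g x)\<^sup>2 / 2 * ?N (x - y)) \<partial>lborel) \<partial>lborel)
      + (\<integral>\<^sup>+x. (\<integral>\<^sup>+y. ennreal ((g y)\<^sup>2 / 2 * ?N (x - y)) \<partial>lborel) \<partial>lborel)"
    by (simp add: nn_integral_add)
  also have "(\<integral>\<^sup>+x. (\<integral>\<^sup>+y. ennreal ((g y)\<^sup>2 / 2 * ?N (x - y)) \<partial>lborel) \<partial>lborel)
     = (\<integral>\<^sup>+y. (\<integral>\<^sup>+x. ennreal ((g y)\<^sup>2 / 2 * ?N (x - y)) \<partial>lborel) \<partial>lborel)"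
    by (rule lborel_pair.Fubini') measurable
  also have "\<dots> = (\<integral>\<^sup>+y. ennreal ((g y)\<^sup>2 / 2) \<partial>lborel)"
    by (intro nn_integral_cong mass(1)) simp
  also have "(\<integral>\<^sup>+x. (\<integral>\<^sup>+y. ennreal ((g x)\<^sup>2 / 2 * ?N (x - y)) \<partial>lborel) \<partial>lborel) = (\<integral>\<^sup>+y. ennreal ((g y)\<^sup>2 / 2) \<partial>lborel)"
    by (intro nn_integral_cong mass(2)) simp
  also have "(\<integral>\<^sup>+y. ennreal ((g y)\<^sup>2 / 2) \<partial>lborel) + (\<integral>\<^sup>+y. ennreal ((g y)\<^sup>2 / 2) \<partial>lborel) = (\<integral>\<^sup>+x. ennreal ((g x)\<^sup>2) \<partial>lborel)"
    by (subst nn_integral_add[symmetric]) (auto simp: ennreal_plus[symmetric] simp del: ennreal_plus)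
  finally show ?thesis .
qed

text \<open>By \<open>gauss_form_le\<close> the Gaussian-weighted integrals are bounded
  independently of \<open>s\<close>, and the weights tend to 1 as \<open>s\<close> tends to
  0.\<close>

lemma nn_integral_fourier_squared_le:
  assumes g: "integrable lborel g"
  shows "(\<integral>\<^sup>+t. ennreal ((cmod (fourier g t))\<^sup>2) \<partial>lborel) \<le> ennreal (2 * pi) * (\<integral>\<^sup>+x. ennreal ((g x)\<^sup>2) \<partial>lborel)"
proof (rule nn_integral_le_of_tendsto)
  note [measurable] = borel_measurable_fourier[OF g]
  let ?s = "\<lambda>j. 1 / real (Suc j)"
  let ?u = "\<lambda>j t. ennreal ((cmod (fourier g t))\<^sup>2 * exp (- (?s j * t)\<^sup>2 / 2))"
  show "?u j \<in> borel_measurable lborel" for j by measurable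
  have s0: "?s \<longlonglongrightarrow> 0" using LIMSEQ_inverse_real_of_nat by (simp add: inverse_eq_divide)
  show "AE t in lborel. (\<lambda>j. ?u j t) \<longlonglongrightarrow> ennreal ((cmod (fourier g t))\<^sup>2)"
  proof (intro AE_I2 tendsto_ennrealI)
    fix t
    have "(\<lambda>j. (cmod (fourier g t))\<^sup>2 * exp (- (?s j * t)\<^sup>2 / 2)) \<longlonglongrightarrow> (cmod (fourier g t))\<^sup>2 * exp (- (0 * t)\<^sup>2 / 2)"
      by (intro tendsto_intros s0) auto
    then show "(\<lambda>j. (cmod (fourier g t))\<^sup>2 * exp (- (?s j * t)\<^sup>2 / 2)) \<longlonglongrightarrow> (cmod (fourier g t))\<^sup>2" by simp
  qed
  show "(\<integral>\<^sup>+t. ?u j t \<partial>lborel) \<le> ennreal (2 * pi) * (\<integral>\<^sup>+x. ennreal ((g x)\<^sup>2) \<partial>lborel)" for j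
    using gauss_form_le[OF g, of "?s j"]
    by (subst nn_integral_fourier_gauss[OF g]) (auto simp: ennreal_mult' intro!: mult_left_mono)
qed

text \<open>Substituting y = x - s z, the smoothed function is an average of translates of
  \<open>g\<close> over a standard normal z. The L^1 error is therefore at most the average
  translation error at -s z, which tends to 0 by dominated convergence.\<close>

lemma conv_gauss_tendsto_L1:
  assumes g: "integrable lborel g" and s0: "s \<longlonglongrightarrow> 0" and s: "\<And>j. s j > 0"
  shows "(\<lambda>j. \<integral>x. norm (conv (normal_density 0 (s j)) g x - g x) \<partial>lborel) \<longlonglongrightarrow> 0"
proof -
  have [measurable]: "g \<in> borel_measurable borel" using g by auto
  let ?N = "std_normal_density"
  define \<tau> where "\<tau> u = (\<integral>x. \<bar>g (x + u) - g x\<bar> \<partial>lborel)" for u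
  have \<tau>m[measurable]: "\<tau> \<in> borel_measurable borel" unfolding \<tau>_def[abs_def] by measurable
  have \<tau>0: "0 \<le> \<tau> u" for u by (simp add: \<tau>_def)
  \<comment> \<open>Comparison with the zero function bounds the translation error uniformly in the
    shift; this yields the integrable majorant.\<close>
  have \<tau>b: "\<tau> u \<le> 2 * (\<integral>x. \<bar>g x\<bar> \<partial>lborel)" for u
    using integral_translate_abs_diff_le[OF g, of "\<lambda>_. 0" u] by (simp add: \<tau>_def)
  have int: "integrable lborel (\<lambda>z. ?N z * \<tau> (- s j * z))" for j
    by (rule integrable_mult_bounded[where B = "2 * (\<integral>x. \<bar>g x\<bar> \<partial>lborel)"]) (use \<tau>b \<tau>0 in auto)
  have bound: "(\<integral>x. norm (conv (normal_density 0 (s j)) g x - g x) \<partial>lborel) \<le> (\<integral>z. ?N z * \<tau> (- s j * z) \<partial>lborel)" for j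
  proof -
    have diff: "conv (normal_density 0 (s j)) g x - g x = (\<integral>z. ?N z * (g (x + (- s j * z)) - g x) \<partial>lborel)" for x
    proof -
      have "conv (normal_density 0 (s j)) g x = (\<integral>y. normal_density 0 (s j) y * g (x - y) \<partial>lborel)"
        using integral_reflect_translate[of "\<lambda>y. normal_density 0 (s j) y * g (x - y)" x] by (simp add: conv_def)
      also have "\<dots> = (\<integral>z. s j * (normal_density 0 (s j) (s j * z) * g (x - s j * z)) \<partial>lborel)"
        using lborel_integral_real_affine[of "s j" "\<lambda>y. normal_density 0 (s j) y * g (x - y)" 0] s[of j] by simp
      also have "\<dots> = (\<integral>z. ?N z * g (x + (- s j * z)) \<partial>lborel)"
        using s[of j] by (intro Bochner_Integration.integral_cong refl)
          (simp add: normal_density_def power_mult_distrib real_sqrt_mult field_simps)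
      finally have "conv (normal_density 0 (s j)) g x = (\<integral>z. ?N z * g (x + (- s j * z)) \<partial>lborel)" .
      moreover have "g x = (\<integral>z. ?N z * g x \<partial>lborel)" by simp
      moreover have "integrable lborel (\<lambda>z. ?N z * g (x + (- s j * z)))"
        using integrable_mult_bounded[OF lborel_integrable_real_affine[OF g, of "- s j" x], of ?N "1 / sqrt (2 * pi)"]
          normal_density_le[of 1] s[of j] by (simp add: mult.commute)
      ultimately show ?thesis
        by (simp add: right_diff_distrib)
    qed
    have "ennreal (\<integral>x. norm (conv (normal_density 0 (s j)) g x - g x) \<partial>lborel)
       = (\<integral>\<^sup>+x. ennreal \<bar>conv (normal_density 0 (s j)) g x - g x\<bar> \<partial>lborel)"
      using g integrable_conv[OF _ g] s[of j]
      by (subst nn_integral_eq_integral) auto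
    also have "\<dots> \<le> (\<integral>\<^sup>+x. (\<integral>\<^sup>+z. ennreal \<bar>?N z * (g (x + (- s j * z)) - g x)\<bar> \<partial>lborel) \<partial>lborel)"
      unfolding diff by (intro nn_integral_mono ennreal_abs_integral_le) measurable
    also have "\<dots> = (\<integral>\<^sup>+z. (\<integral>\<^sup>+x. ennreal \<bar>?N z * (g (x + (- s j * z)) - g x)\<bar> \<partial>lborel) \<partial>lborel)"
      by (rule lborel_pair.Fubini') measurable
    also have "\<dots> = (\<integral>\<^sup>+z. ennreal (?N z * \<tau> (- s j * z)) \<partial>lborel)"
    proof (rule nn_integral_cong)
      fix z
      have "integrable lborel (\<lambda>x. \<bar>?N z * (g (x + (- s j * z)) - g x)\<bar>)"
        by (intro integrable_abs integrable_mult_right Bochner_Integration.integrable_diff integrable_translate g)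
      then show "(\<integral>\<^sup>+x. ennreal \<bar>?N z * (g (x + (- s j * z)) - g x)\<bar> \<partial>lborel) = ennreal (?N z * \<tau> (- s j * z))"
        unfolding \<tau>_def by (subst nn_integral_eq_integral) (auto simp: abs_mult)
    qed
    also have "\<dots> = ennreal (\<integral>z. ?N z * \<tau> (- s j * z) \<partial>lborel)"
      using int[of j] \<tau>0 by (intro nn_integral_eq_integral) auto
    finally show ?thesis
      using \<tau>0 by (subst (asm) ennreal_le_iff) auto
  qed
  have "(\<lambda>j. \<integral>z. ?N z * \<tau> (- s j * z) \<partial>lborel) \<longlonglongrightarrow> (\<integral>z. 0 \<partial>(lborel :: real measure))"
  proof (rule integral_dominated_convergence[where w = "\<lambda>z. ?N z * (2 * (\<integral>x. \<bar>g x\<bar> \<partial>lborel))"])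
    show "AE z in lborel. (\<lambda>j. ?N z * \<tau> (- s j * z)) \<longlonglongrightarrow> 0"
    proof (rule AE_I2, rule tendsto_mult_right_zero)
      fix z
      have "(\<lambda>j. - s j * z) \<longlonglongrightarrow> - 0 * z" by (intro tendsto_intros s0)
      then have "(\<lambda>j. - s j * z) \<longlonglongrightarrow> 0" by simp
      from translation_tendsto_L1[OF g this] show "(\<lambda>j. \<tau> (- s j * z)) \<longlonglongrightarrow> 0" by (simp add: \<tau>_def)
    qed
    show "AE z in lborel. norm (?N z * \<tau> (- s j * z)) \<le> ?N z * (2 * (\<integral>x. \<bar>g x\<bar> \<partial>lborel))" for j
      using \<tau>b \<tau>0 by (intro AE_I2) (simp add: abs_mult mult_left_mono)
  qed auto
  then have lim: "(\<lambda>j. \<integral>z. ?N z * \<tau> (- s j * z) \<partial>lborel) \<longlonglongrightarrow> 0" by simp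
  show ?thesis
    by (rule tendsto_sandwich[OF _ _ tendsto_const lim]) (use bound in auto)
qed

text \<open>For the smoothed function there is an identity with a Gaussian factor at most 1 on the
  frequency side. Dropping that factor gives a bound independent of the width, and Fatou removes the
  smoothing.\<close>

lemma nn_integral_squared_le_fourier:
  assumes g: "integrable lborel g"
  shows "(\<integral>\<^sup>+x. ennreal ((g x)\<^sup>2) \<partial>lborel) \<le> ennreal (1 / (2 * pi)) * (\<integral>\<^sup>+t. ennreal ((cmod (fourier g t))\<^sup>2) \<partial>lborel)"
proof -
  have [measurable]: "g \<in> borel_measurable borel" using g by auto
  note [measurable] = borel_measurable_fourier[OF g]
  define s where "s j = 1 / real (Suc j)" for j
  have s: "s j > 0" for j by (simp add: s_def)
  have s0: "s \<longlonglongrightarrow> 0" using LIMSEQ_inverse_real_of_nat by (simp add: s_def[abs_def] inverse_eq_divide)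
  have "integrable lborel (\<lambda>x. conv (normal_density 0 (s j)) g x - g x)" for j
    using g integrable_conv[OF _ g] s[of j] by auto
  \<comment> \<open>Fatou needs pointwise convergence, which L^1 convergence provides almost
    everywhere along a subsequence.\<close>
  from tendsto_L1_AE_subseq[OF this conv_gauss_tendsto_L1[OF g s0 s]]
  obtain r :: "nat \<Rightarrow> nat" where r: "AE x in lborel. (\<lambda>j. conv (normal_density 0 (s (r j))) g x - g x) \<longlonglongrightarrow> 0"
    by auto
  show ?thesis
  proof (rule nn_integral_le_of_tendsto)
    let ?u = "\<lambda>j x. ennreal ((conv (normal_density 0 (s (r j))) g x)\<^sup>2)"
    show "?u j \<in> borel_measurable lborel" for j by measurable
    show "AE x in lborel. (\<lambda>j. ?u j x) \<longlonglongrightarrow> ennreal ((g x)\<^sup>2)"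
      using r by eventually_elim (intro tendsto_ennrealI tendsto_power, simp add: LIM_zero_cancel)
    show "(\<integral>\<^sup>+x. ?u j x \<partial>lborel) \<le> ennreal (1 / (2 * pi)) * (\<integral>\<^sup>+t. ennreal ((cmod (fourier g t))\<^sup>2) \<partial>lborel)" for j
    proof -
      let ?D = "\<integral>x. g x * conv (normal_density 0 (sqrt 2 * s (r j))) g x \<partial>lborel"
      have "(\<integral>\<^sup>+x. ?u j x \<partial>lborel) = ennreal (1 / (2 * pi) * (2 * pi * ?D))"
        using nn_integral_conv_gauss_squared[OF g s] by simp
      also have "\<dots> = ennreal (1 / (2 * pi)) * ennreal (2 * pi * ?D)"
        by (subst ennreal_mult') auto
      also have "ennreal (2 * pi * ?D) = (\<integral>\<^sup>+t. ennreal ((cmod (fourier g t))\<^sup>2 * exp (- (sqrt 2 * s (r j) * t)\<^sup>2 / 2)) \<partial>lborel)"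
        by (rule nn_integral_fourier_gauss[OF g, symmetric]) (use s in simp)
      also have "ennreal (1 / (2 * pi)) * \<dots> \<le> ennreal (1 / (2 * pi)) * (\<integral>\<^sup>+t. ennreal ((cmod (fourier g t))\<^sup>2) \<partial>lborel)"
        by (intro mult_left_mono nn_integral_mono ennreal_leI) (auto intro!: mult_left_le)
      finally show ?thesis .
    qed
  qed
qed

subsection \<open>Mean integrated squared error\<close>

lemma fourier_conv:
  assumes h: "integrable lborel h" and g: "integrable lborel g"
  shows "fourier (conv h g) t = fourier h t * fourier g t"
proof -
  have [measurable]: "h \<in> borel_measurable borel" "g \<in> borel_measurable borel" using h g by auto
  let ?F = "\<lambda>x y. cis (t * x) * complex_of_real (h (x - y) * g y)"
  have int: "integrable (lborel \<Otimes>\<^sub>M lborel) (\<lambda>(x, y). ?F x y)"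
  proof (rule Bochner_Integration.integrable_bound[OF integrable_conv_pair[OF h g]])
    show "(\<lambda>(x, y). ?F x y) \<in> borel_measurable (lborel \<Otimes>\<^sub>M lborel)"
      unfolding cis_conv_exp by measurable
  qed (auto simp: norm_mult abs_mult)
  have "fourier (conv h g) t = (\<integral>x. (\<integral>y. ?F x y \<partial>lborel) \<partial>lborel)"
    by (simp add: fourier_def conv_def flip: of_real_mult)
  also have "\<dots> = (\<integral>y. (\<integral>x. ?F x y \<partial>lborel) \<partial>lborel)"
    using lborel_pair.Fubini_integral[OF int] by simp
  also have "\<dots> = (\<integral>y. fourier h t * (cis (t * y) * complex_of_real (g y)) \<partial>lborel)"
  proof (rule Bochner_Integration.integral_cong[OF refl])
    fix y
    have "(\<integral>x. ?F x y \<partial>lborel) = (\<integral>x. ?F (y + x) y \<partial>lborel)"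
      using lborel_integral_real_affine[of 1 "\<lambda>x. ?F x y" y] by simp
    also have "\<dots> = (\<integral>x. (cis (t * x) * complex_of_real (h x)) * (cis (t * y) * complex_of_real (g y)) \<partial>lborel)"
      by (intro Bochner_Integration.integral_cong refl) (simp add: distrib_left cis_mult[symmetric] mult_ac)
    also have "\<dots> = fourier h t * (cis (t * y) * complex_of_real (g y))"
      unfolding fourier_def by (rule integral_mult_left_zero)
    finally show "(\<integral>x. ?F x y \<partial>lborel) = \<dots>" .
  qed
  also have "\<dots> = fourier h t * fourier g t"
    unfolding fourier_def by (rule integral_mult_right_zero)
  finally show ?thesis .
qed

lemma fourier_diff:
  assumes "integrable lborel h" "integrable lborel g"
  shows "fourier (\<lambda>x. h x - g x) t = fourier h t - fourier g t"
  unfolding fourier_def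
  by (subst Bochner_Integration.integral_diff[OF integrable_fourier[OF assms(1)] integrable_fourier[OF assms(2)], symmetric])
     (simp add: right_diff_distrib)

lemma integrable_scaled_kernel:
  assumes "integrable lborel K" "h > 0"
  shows "integrable lborel (scaled_kernel K h)"
  using lborel_integrable_real_affine[OF assms(1), of "1 / h" 0] assms(2)
  by (simp add: scaled_kernel_def[abs_def] mult.commute)

lemma fourier_scaled_kernel:
  assumes "h > 0"
  shows "fourier (scaled_kernel K h) t = fourier K (h * t)"
proof -
  have "fourier (scaled_kernel K h) t = \<bar>h\<bar> *\<^sub>R (\<integral>x. cis (t * (0 + h * x)) * complex_of_real (scaled_kernel K h (0 + h * x)) \<partial>lborel)"
    unfolding fourier_def using assms by (intro lborel_integral_real_affine) simp
  also have "\<dots> = (\<integral>x. \<bar>h\<bar> *\<^sub>R (cis (t * (0 + h * x)) * complex_of_real (scaled_kernel K h (0 + h * x))) \<partial>lborel)"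
    by (rule integral_scaleR_right[symmetric])
  also have "\<dots> = fourier K (h * t)"
    unfolding fourier_def using assms
    by (intro Bochner_Integration.integral_cong refl) (simp add: scaled_kernel_def scaleR_conv_of_real mult_ac)
  finally show ?thesis .
qed

lemma fourier_minus: "fourier g (- t) = cnj (fourier g t)"
  unfolding fourier_def by (subst Bochner_Integration.integral_cnj[symmetric]) (simp add: cis_cnj)

text \<open>A frequency u >= 0 where the transform is not 1 would belong to the set whose infimum is
  \<open>S_K K\<close>. Negative frequencies follow by conjugation, since \<open>K\<close> is
  real.\<close>

lemma fourier_eq_1_below_S_K:
  assumes "\<bar>t\<bar> < S_K K"
  shows "fourier K t = 1"
proof -
  have *: "fourier K u = 1" if "0 \<le> u" "u < S_K K" for u
  proof (rule ccontr)
    assume "fourier K u \<noteq> 1"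
    then have "S_K K \<le> u" unfolding S_K_def
      using that by (intro cInf_lower) (auto intro: bdd_belowI[of _ 0])
    with that show False by simp
  qed
  show ?thesis
  proof (cases "t \<ge> 0")
    case False
    with assms have "fourier K (- t) = 1" by (intro *) auto
    then show ?thesis by (simp add: fourier_minus)
  qed (use assms in \<open>auto intro: *\<close>)
qed

section \<open>Sums of independent centred terms and the bias-variance bound\<close>

lemma expectation_empirical_sum_squared:
  fixes Z :: "'a \<Rightarrow> real"
  assumes M: "prob_space M" and Z: "Z \<in> borel_measurable M" and B: "\<And>x. \<bar>Z x\<bar> \<le> B" and mean: "(\<integral>x. Z x \<partial>M) = 0"
    and X: "Q = PiM {..<n::nat} (\<lambda>_. M)"
  shows "integrable Q (\<lambda>X. \<Sum>i<n. Z (X i))" "(\<integral>X. (\<Sum>i<n. Z (X i)) \<partial>Q) = 0"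
    and "integrable Q (\<lambda>X. (\<Sum>i<n. Z (X i))\<^sup>2)" "(\<integral>X. (\<Sum>i<n. Z (X i))\<^sup>2 \<partial>Q) = real n * (\<integral>x. (Z x)\<^sup>2 \<partial>M)"
proof -
  interpret M: prob_space M by fact
  interpret product_prob_space "\<lambda>_::nat. M" "{..<n}" by unfold_locales
  interpret Q: prob_space Q unfolding X by (rule prob_space_PiM) (rule M)
  have intZ: "integrable M Z" by (rule M.integrable_const_bound[of _ B]) (use Z B in auto)
  have intZ2: "integrable M (\<lambda>x. Z x * Z x)" using integrable_mult_bounded[OF intZ Z B] .
  have Zi: "(\<lambda>X. Z (X i)) \<in> borel_measurable Q" if "i < n" for i
    unfolding X using that by (intro measurable_compose[where N = M, OF _ Z] measurable_component_singleton) auto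
  have 1: "integrable Q (\<lambda>X. Z (X i))" if "i < n" for i
    by (rule Q.integrable_const_bound[of _ B]) (use Zi[OF that] B in auto)
  have 2: "integrable Q (\<lambda>X. Z (X i) * Z (X j))" if "i < n" "j < n" for i j
    by (rule integrable_mult_bounded[OF 1[OF that(1)] Zi[OF that(2)] B])
  have e1: "(\<integral>X. Z (X i) \<partial>Q) = 0" if "i < n" for i
  proof -
    have "(\<integral>X. Z (X i) \<partial>Q) = (\<integral>x. Z x \<partial>distr Q M (\<lambda>X. X i))"
      unfolding X using that by (subst integral_distr) (auto intro: Z)
    also have "distr Q M (\<lambda>X. X i) = M" unfolding X using PiM_component[of i] that by simp
    finally show ?thesis using mean by simp
  qed
  have e2: "(\<integral>X. Z (X i) * Z (X j) \<partial>Q) = (if i = j then \<integral>x. (Z x)\<^sup>2 \<partial>M else 0)" if ij: "i < n" "j < n" for i j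
  proof -
    \<comment> \<open>The two factors are spread over all coordinates, so that one product formula
      covers both i = j and distinct indices; in the latter case a factor of mean 0 remains.\<close>
    define F where "F k = (\<lambda>x. (if k = i then Z x else 1) * (if k = j then Z x else 1))" for k
    have F: "integrable M (F k)" for k using intZ intZ2 by (cases "k = i"; cases "k = j") (auto simp: F_def)
    have "Z (X i) * Z (X j) = (\<Prod>k<n. F k (X k))" for X :: "nat \<Rightarrow> 'a"
      unfolding F_def prod.distrib using ij by (simp add: prod.delta)
    then have "(\<integral>X. Z (X i) * Z (X j) \<partial>Q) = (\<Prod>k<n. \<integral>x. F k x \<partial>M)"
      unfolding X using product_integral_prod[OF finite_lessThan F] by simp
    also have "\<dots> = (if i = j then \<integral>x. (Z x)\<^sup>2 \<partial>M else 0)"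
    proof (cases "i = j")
      case True
      then have "(\<integral>x. F k x \<partial>M) = (if k = i then \<integral>x. (Z x)\<^sup>2 \<partial>M else 1)" for k
        by (auto simp: F_def M.prob_space power2_eq_square)
      then show ?thesis using ij True by (simp add: prod.delta)
    next
      case False
      have "(\<integral>x. F i x \<partial>M) = 0" using False mean by (simp add: F_def)
      then show ?thesis using False ij by auto
    qed
    finally show ?thesis .
  qed
  have sq: "(\<Sum>i<n. Z (X i))\<^sup>2 = (\<Sum>i<n. \<Sum>j<n. Z (X i) * Z (X j))" for X
    by (simp add: power2_eq_square sum_product)
  show "integrable Q (\<lambda>X. \<Sum>i<n. Z (X i))" using 1 by auto
  show "(\<integral>X. (\<Sum>i<n. Z (X i)) \<partial>Q) = 0" using 1 e1 by (subst Bochner_Integration.integral_sum) auto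
  show "integrable Q (\<lambda>X. (\<Sum>i<n. Z (X i))\<^sup>2)" unfolding sq by (intro Bochner_Integration.integrable_sum 2) auto
  have "(\<integral>X. (\<Sum>i<n. Z (X i))\<^sup>2 \<partial>Q) = (\<Sum>i<n. \<integral>X. (\<Sum>j<n. Z (X i) * Z (X j)) \<partial>Q)"
    unfolding sq using 2 by (subst Bochner_Integration.integral_sum) auto
  also have "\<dots> = (\<Sum>i<n. \<Sum>j<n. \<integral>X. Z (X i) * Z (X j) \<partial>Q)"
    using 2 by (intro sum.cong refl Bochner_Integration.integral_sum) auto
  also have "\<dots> = (\<Sum>i<n. \<Sum>j<n. if i = j then \<integral>x. (Z x)\<^sup>2 \<partial>M else 0)"
    using e2 by (intro sum.cong refl) auto
  also have "\<dots> = real n * (\<integral>x. (Z x)\<^sup>2 \<partial>M)" by simp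
  finally show "(\<integral>X. (\<Sum>i<n. Z (X i))\<^sup>2 \<partial>Q) = real n * (\<integral>x. (Z x)\<^sup>2 \<partial>M)" .
qed

text \<open>The error is a centred average plus a deterministic bias, and the cross term has mean 0.
  The variance is relaxed to the second moment, whose integral over the evaluation point is later
  computed exactly.\<close>

lemma mean_squared_error_le:
  fixes Y :: "'a \<Rightarrow> real"
  assumes M: "prob_space M" and Y: "Y \<in> borel_measurable M" and B: "\<And>x. \<bar>Y x\<bar> \<le> B" and n: "n \<ge> 1"
  shows "(\<integral>\<^sup>+X. ennreal (((\<Sum>i<n. Y (X i)) / real n - c)\<^sup>2) \<partial>PiM {..<n} (\<lambda>_. M))
    \<le> ennreal ((\<integral>x. (Y x)\<^sup>2 \<partial>M) / real n) + ennreal (((\<integral>x. Y x \<partial>M) - c)\<^sup>2)"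
proof -
  interpret M: prob_space M by fact
  define Q where "Q = PiM {..<n} (\<lambda>_. M)"
  interpret Q: prob_space Q unfolding Q_def by (rule prob_space_PiM) (rule M)
  define m where "m = (\<integral>x. Y x \<partial>M)"
  define Z where "Z x = Y x - m" for x
  have intY: "integrable M Y" by (rule M.integrable_const_bound[of _ B]) (use Y B in auto)
  have intY2: "integrable M (\<lambda>x. (Y x)\<^sup>2)"
    unfolding power2_eq_square by (rule integrable_mult_bounded[OF intY Y B])
  have Zm: "Z \<in> borel_measurable M" unfolding Z_def using Y by measurable
  have Zb: "\<bar>Z x\<bar> \<le> B + \<bar>m\<bar>" for x using B[of x] by (simp add: Z_def)
  have mean: "(\<integral>x. Z x \<partial>M) = 0" unfolding Z_def using intY by (simp add: m_def M.prob_space)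
  note S = expectation_empirical_sum_squared[OF M Zm Zb mean Q_def]
  let ?S = "\<lambda>X. \<Sum>i<n. Z (X i)"
  have eq: "((\<Sum>i<n. Y (X i)) / real n - c)\<^sup>2 = (?S X)\<^sup>2 / (real n)\<^sup>2 + 2 * (m - c) / real n * ?S X + (m - c)\<^sup>2" for X
  proof -
    have "(\<Sum>i<n. Y (X i)) / real n - c = ?S X / real n + (m - c)"
      using n by (simp add: Z_def sum_subtractf field_simps)
    then show ?thesis by (simp only: power2_sum power_divide) (simp add: mult_ac)
  qed
  have int: "integrable Q (\<lambda>X. (?S X)\<^sup>2 / (real n)\<^sup>2 + 2 * (m - c) / real n * ?S X + (m - c)\<^sup>2)"
    using S(1,3) by auto
  have nonneg: "0 \<le> (?S X)\<^sup>2 / (real n)\<^sup>2 + 2 * (m - c) / real n * ?S X + (m - c)\<^sup>2" for X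
    unfolding eq[symmetric] by simp
  have "(\<integral>\<^sup>+X. ennreal (((\<Sum>i<n. Y (X i)) / real n - c)\<^sup>2) \<partial>Q)
      = ennreal (\<integral>X. (?S X)\<^sup>2 / (real n)\<^sup>2 + 2 * (m - c) / real n * ?S X + (m - c)\<^sup>2 \<partial>Q)"
    unfolding eq by (intro nn_integral_eq_integral int AE_I2 nonneg)
  also have "(\<integral>X. (?S X)\<^sup>2 / (real n)\<^sup>2 + 2 * (m - c) / real n * ?S X + (m - c)\<^sup>2 \<partial>Q)
     = (\<integral>x. (Z x)\<^sup>2 \<partial>M) / real n + (m - c)\<^sup>2"
    using S n by (simp add: Q.prob_space power2_eq_square)
  also have "ennreal \<dots> \<le> ennreal ((\<integral>x. (Y x)\<^sup>2 \<partial>M) / real n + (m - c)\<^sup>2)"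
  proof -
    have "(\<integral>x. (Z x)\<^sup>2 \<partial>M) = (\<integral>x. (Y x)\<^sup>2 \<partial>M) - m\<^sup>2"
      using M.variance_eq[OF intY intY2] by (simp add: Z_def m_def)
    then show ?thesis by (intro ennreal_leI add_right_mono divide_right_mono) auto
  qed
  finally show ?thesis by (simp add: Q_def m_def)
qed

text \<open>Tonelli moves the evaluation point outside, where \<open>mean_squared_error_le\<close>
  applies with \<open>Y\<close> the scaled kernel centred at that point. The mean of
  \<open>Y\<close> under the density is the convolution of the scaled kernel with
  \<open>f\<close>.\<close>

lemma MISE_le_variance_bias:
  assumes K: "is_kernel K" and K2: "square_integrable K" and f: "is_density f"
    and n: "n \<ge> 1" and h: "h > 0"
  shows "MISE n f K h \<le> ennreal ((\<integral>x. (K x)\<^sup>2 \<partial>lborel) / (real n * h))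
    + (\<integral>\<^sup>+x. ennreal ((conv (scaled_kernel K h) f x - f x)\<^sup>2) \<partial>lborel)"
proof -
  let ?k = "scaled_kernel K h"
  define M where "M = density lborel (\<lambda>x. ennreal (f x))"
  have fm[measurable]: "f \<in> borel_measurable borel" and f0: "\<And>x. 0 \<le> f x" and fint: "integrable lborel f"
    and f1: "(\<integral>x. f x \<partial>lborel) = 1"
    using f by (auto simp: is_density_def)
  have Kint: "integrable lborel K" using K by (simp add: is_kernel_def)
  then have [measurable]: "K \<in> borel_measurable borel" by auto
  obtain B where B: "\<And>x. \<bar>K x\<bar> \<le> B" using K by (auto simp: is_kernel_def bounded_iff)
  have km[measurable]: "?k \<in> borel_measurable borel" unfolding scaled_kernel_def[abs_def] by measurable
  have kB: "\<bar>?k x\<bar> \<le> B / h" for x using B h by (simp add: scaled_kernel_def divide_right_mono)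
  have M: "prob_space M"
    unfolding M_def using f1 fint f0
    by (intro prob_spaceI) (simp add: emeasure_density nn_integral_eq_integral)
  interpret M: prob_space M by fact
  have [measurable_cong]: "sets M = sets borel" by (simp add: M_def)
  define Q where "Q = PiM {..<n} (\<lambda>_. M)"
  interpret Q: prob_space Q unfolding Q_def by (rule prob_space_PiM) (rule M)
  interpret pair_sigma_finite Q lborel ..
  \<comment> \<open>Tonelli requires joint measurability in sample and point; it is assembled from
    the coordinates below \<open>n\<close>, the index set of the product measure.\<close>
  have comp: "(\<lambda>(X, x). X i) \<in> borel_measurable (Q \<Otimes>\<^sub>M lborel)" if "i < n" for i
  proof -
    have "(\<lambda>X. X i) \<in> measurable Q M" unfolding Q_def using that by (intro measurable_component_singleton) simp
    then have "(\<lambda>X. X i) \<in> borel_measurable Q" by (simp add: M_def)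
    from measurable_compose[OF measurable_fst this, of lborel] show ?thesis by (simp only: case_prod_beta')
  qed
  have kdem: "(\<lambda>(X, x). kde n K h X x) \<in> borel_measurable (Q \<Otimes>\<^sub>M lborel)"
  proof -
    have "(\<lambda>(X, x). ?k (x - X i)) \<in> borel_measurable (Q \<Otimes>\<^sub>M lborel)" if "i < n" for i
    proof -
      note [measurable] = comp[OF that]
      have "(\<lambda>p. ?k (snd p - (\<lambda>(X, x). X i) p)) \<in> borel_measurable (Q \<Otimes>\<^sub>M lborel)"
        by measurable
      then show ?thesis by (simp add: case_prod_beta)
    qed
    then have "(\<lambda>p. (\<Sum>i<n. (\<lambda>(X, x). ?k (x - X i)) p) / real n) \<in> borel_measurable (Q \<Otimes>\<^sub>M lborel)"
      by (intro borel_measurable_divide borel_measurable_sum) auto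
    then show ?thesis by (simp add: kde_def case_prod_beta)
  qed
  have m2: "(\<lambda>(X, x). ennreal ((kde n K h X x - f x)\<^sup>2)) \<in> borel_measurable (Q \<Otimes>\<^sub>M lborel)"
  proof -
    note [measurable] = kdem
    have "(\<lambda>p. ennreal (((\<lambda>(X, x). kde n K h X x) p - f (snd p))\<^sup>2)) \<in> borel_measurable (Q \<Otimes>\<^sub>M lborel)" by measurable
    then show ?thesis by (simp add: case_prod_beta)
  qed
  have "MISE n f K h = (\<integral>\<^sup>+x. (\<integral>\<^sup>+X. ennreal ((kde n K h X x - f x)\<^sup>2) \<partial>Q) \<partial>lborel)"
    unfolding MISE_def sample_law_def M_def[symmetric] Q_def[symmetric] by (rule Fubini'[OF m2, symmetric])
  also have "\<dots> \<le> (\<integral>\<^sup>+x. (\<integral>\<^sup>+y. ennreal ((?k (x - y))\<^sup>2 / real n) * ennreal (f y) \<partial>lborel)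
      + ennreal ((conv ?k f x - f x)\<^sup>2) \<partial>lborel)"
  proof (rule nn_integral_mono)
    fix x
    have "(\<integral>\<^sup>+X. ennreal ((kde n K h X x - f x)\<^sup>2) \<partial>Q)
      \<le> ennreal ((\<integral>y. (?k (x - y))\<^sup>2 \<partial>M) / real n) + ennreal (((\<integral>y. ?k (x - y) \<partial>M) - f x)\<^sup>2)"
      unfolding kde_def Q_def by (rule mean_squared_error_le[OF M _ kB n]) measurable
    also have "(\<integral>y. ?k (x - y) \<partial>M) = conv ?k f x"
      unfolding M_def conv_def using f0 by (subst integral_density) (auto simp: mult.commute)
    also have "ennreal ((\<integral>y. (?k (x - y))\<^sup>2 \<partial>M) / real n) = (\<integral>\<^sup>+y. ennreal ((?k (x - y))\<^sup>2 / real n) \<partial>M)"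
    proof -
      have "(?k y)\<^sup>2 \<le> (B / h)\<^sup>2" for y using power_mono[OF kB[of y], of 2] by simp
      then have "integrable M (\<lambda>y. (?k (x - y))\<^sup>2 / real n)"
        by (intro integrable_divide M.integrable_const_bound[of _ "(B / h)\<^sup>2"]) auto
      then show ?thesis by (subst nn_integral_eq_integral) auto
    qed
    also have "\<dots> = (\<integral>\<^sup>+y. ennreal ((?k (x - y))\<^sup>2 / real n) * ennreal (f y) \<partial>lborel)"
      unfolding M_def by (subst nn_integral_density) (auto simp: mult.commute)
    finally show "(\<integral>\<^sup>+X. ennreal ((kde n K h X x - f x)\<^sup>2) \<partial>Q) \<le> \<dots> + ennreal ((conv ?k f x - f x)\<^sup>2)" .
  qed
  also have "\<dots> = (\<integral>\<^sup>+x. (\<integral>\<^sup>+y. ennreal ((?k (x - y))\<^sup>2 / real n) * ennreal (f y) \<partial>lborel) \<partial>lborel)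
      + (\<integral>\<^sup>+x. ennreal ((conv ?k f x - f x)\<^sup>2) \<partial>lborel)"
    by (rule nn_integral_add) measurable
  \<comment> \<open>With \<open>x\<close> integrated first, the inner kernel integral does not
    depend on \<open>y\<close>, so the density contributes only its mass 1.\<close>
  also have "(\<integral>\<^sup>+x. (\<integral>\<^sup>+y. ennreal ((?k (x - y))\<^sup>2 / real n) * ennreal (f y) \<partial>lborel) \<partial>lborel)
     = (\<integral>\<^sup>+y. (\<integral>\<^sup>+x. ennreal ((?k (x - y))\<^sup>2 / real n) * ennreal (f y) \<partial>lborel) \<partial>lborel)"
    by (rule lborel_pair.Fubini') measurable
  also have "\<dots> = (\<integral>\<^sup>+y. ennreal ((\<integral>x. (K x)\<^sup>2 \<partial>lborel) / (real n * h)) * ennreal (f y) \<partial>lborel)"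
  proof (rule nn_integral_cong)
    fix y
    have K2int: "integrable lborel (\<lambda>x. (K x)\<^sup>2)" using K2 by (simp add: square_integrable_def)
    have "(\<integral>\<^sup>+x. ennreal ((?k (x - y))\<^sup>2 / real n) \<partial>lborel) = (\<integral>\<^sup>+x. ennreal ((?k x)\<^sup>2 / real n) \<partial>lborel)"
      using nn_integral_translate[of "\<lambda>x. ennreal ((?k x)\<^sup>2 / real n)" "- y"] by simp
    also have "\<dots> = ennreal h * (\<integral>\<^sup>+x. ennreal ((?k (h * x))\<^sup>2 / real n) \<partial>lborel)"
      using nn_integral_real_affine[of "\<lambda>x. ennreal ((?k x)\<^sup>2 / real n)" h 0] h by simp
    also have "\<dots> = (\<integral>\<^sup>+x. ennreal ((K x)\<^sup>2 / (real n * h)) \<partial>lborel)"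
      using h by (subst nn_integral_cmult[symmetric])
        (auto simp: scaled_kernel_def power_divide power2_eq_square field_simps simp flip: ennreal_mult' intro!: nn_integral_cong)
    also have "\<dots> = ennreal ((\<integral>x. (K x)\<^sup>2 \<partial>lborel) / (real n * h))"
      using K2int h by (subst nn_integral_eq_integral) auto
    finally show "(\<integral>\<^sup>+x. ennreal ((?k (x - y))\<^sup>2 / real n) * ennreal (f y) \<partial>lborel)
      = ennreal ((\<integral>x. (K x)\<^sup>2 \<partial>lborel) / (real n * h)) * ennreal (f y)"
      by (subst nn_integral_multc) auto
  qed
  also have "\<dots> = ennreal ((\<integral>x. (K x)\<^sup>2 \<partial>lborel) / (real n * h))"
    using fint f0 f1 by (subst nn_integral_cmult) (auto simp: nn_integral_eq_integral)
  finally show ?thesis .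
qed

text \<open>Outside the flat region |phi_K - 1| is at most 1 plus the L^1 norm of \<open>K\<close>;
  its square over 2 pi is the constant. What remains for each smoothness class is a tail estimate
  for the transform of \<open>f\<close>.\<close>

lemma MISE_le:
  assumes K: "is_kernel K" and K2: "square_integrable K" and f: "is_density f"
    and n: "n \<ge> 1" and h: "h > 0"
  shows "MISE n f K h \<le> ennreal ((\<integral>x. (K x)\<^sup>2 \<partial>lborel) / (real n * h))
    + ennreal (((\<integral>x. \<bar>K x\<bar> \<partial>lborel) + 1)\<^sup>2 / (2 * pi)) *
      (\<integral>\<^sup>+t. ennreal ((cmod (fourier f t))\<^sup>2) * indicator {t. S_K K / h \<le> \<bar>t\<bar>} t \<partial>lborel)"
proof -
  let ?k = "scaled_kernel K h" and ?\<kappa> = "\<integral>x. \<bar>K x\<bar> \<partial>lborel"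
  have Kint: "integrable lborel K" using K by (simp add: is_kernel_def)
  have fint: "integrable lborel f" using f by (simp add: is_density_def)
  note [measurable] = borel_measurable_fourier[OF fint]
  note kint = integrable_scaled_kernel[OF Kint h]
  have int: "integrable lborel (\<lambda>x. conv ?k f x - f x)"
    using integrable_conv[OF kint fint] fint by auto
  have ft: "fourier (\<lambda>x. conv ?k f x - f x) t = (fourier K (h * t) - 1) * fourier f t" for t
    using fourier_diff[OF integrable_conv[OF kint fint] fint] fourier_conv[OF kint fint] fourier_scaled_kernel[OF h]
    by (simp add: left_diff_distrib)
  have "(\<integral>\<^sup>+x. ennreal ((conv ?k f x - f x)\<^sup>2) \<partial>lborel)
    \<le> ennreal (1 / (2 * pi)) * (\<integral>\<^sup>+t. ennreal ((cmod ((fourier K (h * t) - 1) * fourier f t))\<^sup>2) \<partial>lborel)"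
    using nn_integral_squared_le_fourier[OF int] by (simp add: ft)
  also have "\<dots> \<le> ennreal (1 / (2 * pi)) * (\<integral>\<^sup>+t. ennreal ((?\<kappa> + 1)\<^sup>2) *
      (ennreal ((cmod (fourier f t))\<^sup>2) * indicator {t. S_K K / h \<le> \<bar>t\<bar>} t) \<partial>lborel)"
  proof (intro mult_left_mono nn_integral_mono)
    fix t
    show "ennreal ((cmod ((fourier K (h * t) - 1) * fourier f t))\<^sup>2)
      \<le> ennreal ((?\<kappa> + 1)\<^sup>2) * (ennreal ((cmod (fourier f t))\<^sup>2) * indicator {t. S_K K / h \<le> \<bar>t\<bar>} t)"
    proof (cases "S_K K / h \<le> \<bar>t\<bar>")
      case True
      have "cmod (fourier K (h * t) - 1) \<le> ?\<kappa> + 1"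
        using norm_triangle_ineq4[of "fourier K (h * t)" 1] cmod_fourier_le[OF Kint, of "h * t"] by simp
      then have "(cmod ((fourier K (h * t) - 1) * fourier f t))\<^sup>2 \<le> (?\<kappa> + 1)\<^sup>2 * (cmod (fourier f t))\<^sup>2"
        by (simp add: norm_mult power_mult_distrib mult_right_mono power_mono)
      with True show ?thesis by (simp flip: ennreal_mult add: ennreal_leI)
    next
      case False
      then have "\<bar>h * t\<bar> < S_K K" using h by (simp add: field_simps abs_mult)
      from fourier_eq_1_below_S_K[OF this] show ?thesis by simp
    qed
  qed auto
  also have "\<dots> = ennreal ((?\<kappa> + 1)\<^sup>2 / (2 * pi)) *
      (\<integral>\<^sup>+t. ennreal ((cmod (fourier f t))\<^sup>2) * indicator {t. S_K K / h \<le> \<bar>t\<bar>} t \<partial>lborel)"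
    by (subst nn_integral_cmult) (auto simp: mult.assoc[symmetric] simp flip: ennreal_mult)
  finally show ?thesis
    using MISE_le_variance_bias[OF K K2 f n h] by (meson add_left_mono order_trans)
qed

subsection \<open>Derivatives and finite differences\<close>

text \<open>Local absolute continuity, phrased through increments over all compact intervals. Unlike
  an integral based at 0, this form is visibly preserved by translations and differences.\<close>

definition primitive_of :: "(real \<Rightarrow> real) \<Rightarrow> (real \<Rightarrow> real) \<Rightarrow> bool" where
  "primitive_of h h' \<longleftrightarrow> (\<forall>a b. a \<le> b \<longrightarrow> set_integrable lborel {a..b} h' \<and> h b - h a = (LBINT x:{a..b}. h' x))"

definition fwd_diff :: "real \<Rightarrow> (real \<Rightarrow> real) \<Rightarrow> real \<Rightarrow> real" where
  "fwd_diff u w x = w (x + u) - w x"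

lemma primitive_of_interval_integral:
  fixes h h' :: "real \<Rightarrow> real"
  assumes int: "\<And>a b. a \<le> b \<Longrightarrow> set_integrable lborel {a..b} h'"
    and eq: "\<And>x. h x = h 0 + (LBINT t=0..x. h' t)"
  shows "primitive_of h h'"
  unfolding primitive_of_def
proof (intro allI impI conjI int)
  fix a b :: real assume ab: "a \<le> b"
  \<comment> \<open>Adding the signed integrals requires integrability on the hull of 0,
    \<open>a\<close> and \<open>b\<close>, in whatever order they lie.\<close>
  have "set_integrable lborel {min 0 a..max 0 b} h'" by (rule int) simp
  then have "set_integrable lborel (einterval (min 0 (min (ereal a) (ereal b))) (max 0 (max (ereal a) (ereal b)))) h'"
    by (rule set_integrable_subset) (use ab in \<open>auto simp: einterval_def zero_ereal_def min_def max_def split: if_splits\<close>)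
  then have "interval_lebesgue_integrable lborel (min 0 (min (ereal a) (ereal b))) (max 0 (max (ereal a) (ereal b))) h'"
    by (simp add: interval_lebesgue_integrable_def min_le_iff_disj)
  from interval_integral_sum[OF this] have "(LBINT t=0..a. h' t) + (LBINT t=a..b. h' t) = (LBINT t=0..b. h' t)" .
  then show "h b - h a = (LBINT x:{a..b}. h' x)"
    using eq[of a] eq[of b] interval_integral_Icc[OF ab, of h'] by simp
qed

lemma primitive_of_fwd_diff:
  assumes "primitive_of h h'"
  shows "primitive_of (fwd_diff u h) (fwd_diff u h')"
  unfolding primitive_of_def
proof (intro allI impI)
  fix a b :: real assume ab: "a \<le> b"
  have 1: "set_integrable lborel {a..b} h'" "h b - h a = (LBINT x:{a..b}. h' x)"
    using assms ab by (auto simp: primitive_of_def)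
  have 2: "set_integrable lborel {a + u..b + u} h'" "h (b + u) - h (a + u) = (LBINT x:{a + u..b + u}. h' x)"
    using assms ab by (auto simp: primitive_of_def)
  have ind: "indicat_real {a + u..b + u} (x + u) = indicator {a..b} x" for x
    by (simp add: indicator_def)
  have 3: "set_integrable lborel {a..b} (\<lambda>x. h' (x + u))"
    using integrable_translate[OF 2(1)[unfolded set_integrable_def], of u] by (simp add: set_integrable_def ind)
  have 4: "(LBINT x:{a..b}. h' (x + u)) = (LBINT x:{a + u..b + u}. h' x)"
    using integral_translate[of "\<lambda>x. indicator {a + u..b + u} x *\<^sub>R h' x" u] by (simp add: set_lebesgue_integral_def ind)
  show "set_integrable lborel {a..b} (fwd_diff u h') \<and> fwd_diff u h b - fwd_diff u h a = (LBINT x:{a..b}. fwd_diff u h' x)"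
    unfolding fwd_diff_def[abs_def] using set_integral_diff[OF 3 1(1)] 1(2) 2(2) 4 by auto
qed

text \<open>Local integrability is all that is given: \<open>h'\<close> is the pointwise limit of
  its truncations to [-j, j], and \<open>h\<close> is an integral depending measurably on its
  endpoint.\<close>

lemma primitive_of_measurable:
  assumes "primitive_of h h'"
  shows "h' \<in> borel_measurable borel" "h \<in> borel_measurable borel"
proof -
  have int: "set_integrable lborel {a..b} h'" if "a \<le> b" for a b
    using assms that by (auto simp: primitive_of_def)
  have eq: "h b = h a + (LBINT x:{a..b}. h' x)" if "a \<le> b" for a b
    using assms that by (auto simp: primitive_of_def algebra_simps)
  show h'[measurable]: "h' \<in> borel_measurable borel"
  proof (rule borel_measurable_LIMSEQ_real)
    show "(\<lambda>j. indicator {- real j..real j} x *\<^sub>R h' x) \<longlonglongrightarrow> h' x" for x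
    proof (rule tendsto_eventually)
      obtain N :: nat where "\<bar>x\<bar> \<le> real N" using real_arch_simple by blast
      then show "\<forall>\<^sub>F j in sequentially. indicator {- real j..real j} x *\<^sub>R h' x = h' x"
        by (intro eventually_sequentiallyI[of N]) (auto simp: indicator_def)
    qed
    show "(\<lambda>x. indicator {- real j..real j} x *\<^sub>R h' x) \<in> borel_measurable borel" for j
      using borel_measurable_integrable[OF int[of "- real j" "real j", unfolded set_integrable_def]] by simp
  qed
  \<comment> \<open>Two branches account for the sign of the integral from 0 to \<open>x\<close>;
    conditions in place of interval indicators expose joint measurability in \<open>x\<close> and
    \<open>t\<close>.\<close>
  have "h = (\<lambda>x. if 0 \<le> x then h 0 + (\<integral>t. (if 0 \<le> t \<and> t \<le> x then h' t else 0) \<partial>lborel)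
      else h 0 - (\<integral>t. (if x \<le> t \<and> t \<le> 0 then h' t else 0) \<partial>lborel))"
  proof
    fix x
    have ind: "indicator {a..b} t *\<^sub>R h' t = (if a \<le> t \<and> t \<le> b then h' t else 0)" for a b t
      by (simp add: indicator_def)
    show "h x = (if 0 \<le> x then h 0 + (\<integral>t. (if 0 \<le> t \<and> t \<le> x then h' t else 0) \<partial>lborel)
      else h 0 - (\<integral>t. (if x \<le> t \<and> t \<le> 0 then h' t else 0) \<partial>lborel))"
      using eq[of 0 x] eq[of x 0] unfolding set_lebesgue_integral_def ind by auto
  qed
  also have "\<dots> \<in> borel_measurable borel" by measurable
  finally show "h \<in> borel_measurable borel" .
qed

text \<open>The difference is the integral of \<open>h'\<close> over [x, x + u]. Cauchy-Schwarz
  yields one factor \<open>u\<close>; Tonelli yields the other, since a point s lies in this window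
  exactly for x in [s - u, s].\<close>

lemma nn_integral_fwd_diff_squared_le:
  assumes p: "primitive_of h h'" and u: "u > 0"
  shows "(\<integral>\<^sup>+x. ennreal ((fwd_diff u h x)\<^sup>2) \<partial>lborel) \<le> ennreal (u\<^sup>2) * (\<integral>\<^sup>+x. ennreal ((h' x)\<^sup>2) \<partial>lborel)"
proof -
  note [measurable] = primitive_of_measurable[OF p]
  let ?I = "\<lambda>x s. (indicator {x..x + u} s :: ennreal)"
  have Im[measurable]: "(\<lambda>(x, s). ?I x s) \<in> borel_measurable (borel \<Otimes>\<^sub>M borel)"
  proof -
    have "(\<lambda>(x, s). ?I x s) = (\<lambda>(x, s). if x \<le> s \<and> s \<le> x + u then 1 else 0)"
      by (auto simp: indicator_def fun_eq_iff)
    also have "\<dots> \<in> borel_measurable (borel \<Otimes>\<^sub>M borel)" by measurable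
    finally show ?thesis .
  qed
  have pw: "ennreal ((fwd_diff u h x)\<^sup>2) \<le> ennreal u * (\<integral>\<^sup>+s. ?I x s * ennreal ((h' s)\<^sup>2) \<partial>lborel)" for x
  proof -
    have "fwd_diff u h x = (\<integral>s. indicator {x..x + u} s *\<^sub>R h' s \<partial>lborel)"
      using p u by (simp add: primitive_of_def fwd_diff_def set_lebesgue_integral_def)
    then have "ennreal \<bar>fwd_diff u h x\<bar> \<le> (\<integral>\<^sup>+s. ennreal \<bar>indicator {x..x + u} s *\<^sub>R h' s\<bar> \<partial>lborel)"
      using ennreal_abs_integral_le[of "\<lambda>s. indicator {x..x + u} s *\<^sub>R h' s" lborel] by simp
    \<comment> \<open>The indicator is doubled for Cauchy-Schwarz: one copy supplies the window
      length, the other keeps \<open>h'\<close> restricted to the window.\<close>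
    also have "\<dots> = (\<integral>\<^sup>+s. ?I x s * (?I x s * ennreal \<bar>h' s\<bar>) \<partial>lborel)"
      by (intro nn_integral_cong) (auto simp: indicator_def)
    finally have "(ennreal \<bar>fwd_diff u h x\<bar>)\<^sup>2 \<le> (\<integral>\<^sup>+s. ?I x s * (?I x s * ennreal \<bar>h' s\<bar>) \<partial>lborel)\<^sup>2"
      by (rule power_mono) simp
    also have "\<dots> \<le> (\<integral>\<^sup>+s. (?I x s)\<^sup>2 \<partial>lborel) * (\<integral>\<^sup>+s. (?I x s * ennreal \<bar>h' s\<bar>)\<^sup>2 \<partial>lborel)"
      by (rule Cauchy_Schwarz_nn_integral) measurable
    also have "(\<integral>\<^sup>+s. (?I x s)\<^sup>2 \<partial>lborel) = (\<integral>\<^sup>+s. ?I x s \<partial>lborel)"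
      by (intro nn_integral_cong) (auto simp: indicator_def)
    also have "\<dots> = ennreal u" using u by simp
    also have "(\<integral>\<^sup>+s. (?I x s * ennreal \<bar>h' s\<bar>)\<^sup>2 \<partial>lborel) = (\<integral>\<^sup>+s. ?I x s * ennreal ((h' s)\<^sup>2) \<partial>lborel)"
      by (intro nn_integral_cong) (auto simp: indicator_def ennreal_power)
    finally show ?thesis by (simp add: ennreal_power)
  qed
  have "(\<integral>\<^sup>+x. ennreal ((fwd_diff u h x)\<^sup>2) \<partial>lborel)
      \<le> (\<integral>\<^sup>+x. ennreal u * (\<integral>\<^sup>+s. ?I x s * ennreal ((h' s)\<^sup>2) \<partial>lborel) \<partial>lborel)"
    by (intro nn_integral_mono pw)
  also have "\<dots> = ennreal u * (\<integral>\<^sup>+x. (\<integral>\<^sup>+s. ?I x s * ennreal ((h' s)\<^sup>2) \<partial>lborel) \<partial>lborel)"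
    by (rule nn_integral_cmult) measurable
  also have "(\<integral>\<^sup>+x. (\<integral>\<^sup>+s. ?I x s * ennreal ((h' s)\<^sup>2) \<partial>lborel) \<partial>lborel)
     = (\<integral>\<^sup>+s. (\<integral>\<^sup>+x. ?I x s * ennreal ((h' s)\<^sup>2) \<partial>lborel) \<partial>lborel)"
    by (rule lborel_pair.Fubini') measurable
  also have "\<dots> = (\<integral>\<^sup>+s. ennreal u * ennreal ((h' s)\<^sup>2) \<partial>lborel)"
  proof (rule nn_integral_cong)
    fix s
    have "(\<integral>\<^sup>+x. ?I x s * ennreal ((h' s)\<^sup>2) \<partial>lborel) = (\<integral>\<^sup>+x. ennreal ((h' s)\<^sup>2) * indicator {s - u..s} x \<partial>lborel)"
      by (intro nn_integral_cong) (auto simp: indicator_def)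
    also have "\<dots> = ennreal ((h' s)\<^sup>2) * ennreal u" using u by (subst nn_integral_cmult_indicator) auto
    finally show "(\<integral>\<^sup>+x. ?I x s * ennreal ((h' s)\<^sup>2) \<partial>lborel) = ennreal u * ennreal ((h' s)\<^sup>2)"
      by (simp add: mult.commute)
  qed
  also have "\<dots> = ennreal u * (\<integral>\<^sup>+s. ennreal ((h' s)\<^sup>2) \<partial>lborel)"
    by (rule nn_integral_cmult) measurable
  finally show ?thesis
    using u by (simp add: power2_eq_square ennreal_mult mult.assoc)
qed

text \<open>Each step trades one difference for one derivative at the price of u^2, keeping i + m =
  k. Differences preserve \<open>primitive_of\<close>, so only the last function's L^2 norm
  appears.\<close>

lemma nn_integral_iterated_fwd_diff_le:
  assumes p: "\<And>j. j < k \<Longrightarrow> primitive_of (g j) (g (Suc j))" and u: "u > 0"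
  shows "i + m = k \<Longrightarrow> (\<integral>\<^sup>+x. ennreal (((fwd_diff u ^^ m) (g i) x)\<^sup>2) \<partial>lborel)
    \<le> ennreal (u ^ (2 * m)) * (\<integral>\<^sup>+x. ennreal ((g k x)\<^sup>2) \<partial>lborel)"
proof (induction m arbitrary: i)
  case (Suc m)
  have "primitive_of ((fwd_diff u ^^ l) (g i)) ((fwd_diff u ^^ l) (g (Suc i)))" for l
    using p[of i] Suc.prems by (induction l) (auto intro: primitive_of_fwd_diff)
  note prim = this[of m]
  have "(\<integral>\<^sup>+x. ennreal (((fwd_diff u ^^ Suc m) (g i) x)\<^sup>2) \<partial>lborel)
     \<le> ennreal (u\<^sup>2) * (\<integral>\<^sup>+x. ennreal (((fwd_diff u ^^ m) (g (Suc i)) x)\<^sup>2) \<partial>lborel)"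
    using nn_integral_fwd_diff_squared_le[OF prim u] by simp
  also have "\<dots> \<le> ennreal (u\<^sup>2) * (ennreal (u ^ (2 * m)) * (\<integral>\<^sup>+x. ennreal ((g k x)\<^sup>2) \<partial>lborel))"
    using Suc.prems by (intro mult_left_mono Suc.IH) auto
  also have "\<dots> = ennreal (u ^ (2 * Suc m)) * (\<integral>\<^sup>+x. ennreal ((g k x)\<^sup>2) \<partial>lborel)"
    using u by (simp add: mult.assoc[symmetric] power2_eq_square flip: ennreal_mult)
  finally show ?case .
qed simp

text \<open>A shift by \<open>u\<close> multiplies the transform by the phase exp(-itu).
  Integrability is carried through the same induction because splitting the transform of a
  difference relies on it.\<close>

lemma fourier_iterated_fwd_diff:
  assumes g: "integrable lborel g"
  shows "integrable lborel ((fwd_diff u ^^ m) g) \<and> fourier ((fwd_diff u ^^ m) g) t = (cis (- (t * u)) - 1) ^ m * fourier g t"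
proof (induction m)
  case (Suc m)
  let ?w = "(fwd_diff u ^^ m) g"
  have w: "integrable lborel ?w" using Suc by simp
  have tr: "(\<integral>x. cis (t * x) * complex_of_real (?w (x + u)) \<partial>lborel) = cis (- (t * u)) * fourier ?w t"
  proof -
    have "(\<integral>x. cis (t * x) * complex_of_real (?w (x + u)) \<partial>lborel)
      = (\<integral>x. cis (t * (x - u)) * complex_of_real (?w x) \<partial>lborel)"
      using lborel_integral_real_affine[of 1 "\<lambda>x. cis (t * x) * complex_of_real (?w (x + u))" "- u"] by simp
    also have "\<dots> = (\<integral>x. cis (- (t * u)) * (cis (t * x) * complex_of_real (?w x)) \<partial>lborel)"
      by (intro Bochner_Integration.integral_cong refl) (simp add: right_diff_distrib cis_mult mult.assoc[symmetric])
    also have "\<dots> = cis (- (t * u)) * fourier ?w t"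
      unfolding fourier_def by (rule integral_mult_right_zero)
    finally show ?thesis .
  qed
  have "fourier (fwd_diff u ?w) t = (\<integral>x. cis (t * x) * complex_of_real (?w (x + u)) - cis (t * x) * complex_of_real (?w x) \<partial>lborel)"
    by (simp add: fourier_def fwd_diff_def right_diff_distrib)
  also have "\<dots> = (cis (- (t * u)) - 1) * fourier ?w t"
    by (subst Bochner_Integration.integral_diff[OF integrable_fourier[OF integrable_translate[OF w]] integrable_fourier[OF w]])
      (simp only: tr fourier_def[symmetric] left_diff_distrib mult_1)
  finally have "fourier (fwd_diff u ?w) t = (cis (- (t * u)) - 1) * fourier ?w t" .
  moreover have "integrable lborel (fwd_diff u ?w)"
    unfolding fwd_diff_def[of u ?w, abs_def] using w by (auto intro: integrable_translate)
  ultimately show ?case using Suc by simp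
qed (simp add: g)

text \<open>The bound 2 pi times the squared norm of \<open>d\<close> holds for the k-th difference
  quotient at every step size, since the powers of the step cancel; Fatou passes to step 0.\<close>

lemma nn_integral_fourier_kth_derivative_le:
  assumes d: "has_kth_derivative k f d" and f: "integrable lborel f"
    and k: "k \<ge> 1"
  shows "(\<integral>\<^sup>+t. ennreal (\<bar>t\<bar> ^ (2 * k) * (cmod (fourier f t))\<^sup>2) \<partial>lborel) \<le> ennreal (2 * pi) * (\<integral>\<^sup>+x. ennreal ((d x)\<^sup>2) \<partial>lborel)"
proof -
  obtain g where fg: "AE x in lborel. f x = g 0 x" and gk: "g k = d"
    and int: "\<And>j a b. j < k \<Longrightarrow> a \<le> b \<Longrightarrow> set_integrable lborel {a..b} (g (Suc j))"
    and eq: "\<And>j x. j < k \<Longrightarrow> g j x = g j 0 + (LBINT t=0..x. g (Suc j) t)"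
    using d unfolding has_kth_derivative_def by blast
  have prim: "primitive_of (g j) (g (Suc j))" if "j < k" for j
    by (rule primitive_of_interval_integral[OF int[OF that] eq[OF that]])
  have [measurable]: "f \<in> borel_measurable borel" using f by auto
  have [measurable]: "g 0 \<in> borel_measurable borel" using primitive_of_measurable(2)[OF prim[of 0]] k by simp
  \<comment> \<open>\<open>f\<close> agrees with \<open>g 0\<close> only almost everywhere.
    Differences are taken of \<open>g 0\<close>, which has the required primitives, and its
    transform is that of \<open>f\<close>.\<close>
  have g0: "integrable lborel (g 0)" using integrable_cong_AE_imp[OF f _ fg] by simp
  have four: "fourier f = fourier (g 0)"
    unfolding fourier_def fun_eq_iff cis_conv_exp
    by (intro allI integral_cong_AE) (use fg in auto)
  note [measurable] = borel_measurable_fourier[OF g0]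
  define u where "u j = 1 / real (Suc j)" for j
  have u: "u j > 0" for j by (simp add: u_def)
  have u0: "u \<longlonglongrightarrow> 0" using LIMSEQ_inverse_real_of_nat by (simp add: u_def[abs_def] inverse_eq_divide)
  \<comment> \<open>This is the squared modulus of the transform of the k-th difference of
    \<open>g 0\<close> divided by \<open>u j\<close> to the power k.\<close>
  let ?w = "\<lambda>j t. (cmod (cis (- (t * u j)) - 1) / u j) ^ (2 * k) * (cmod (fourier (g 0) t))\<^sup>2"
  show ?thesis unfolding four
  proof (rule nn_integral_le_of_tendsto)
    show "(\<lambda>t. ennreal (?w j t)) \<in> borel_measurable lborel" for j
      unfolding cis_conv_exp by measurable
    show "AE t in lborel. (\<lambda>j. ennreal (?w j t)) \<longlonglongrightarrow> ennreal (\<bar>t\<bar> ^ (2 * k) * (cmod (fourier (g 0) t))\<^sup>2)"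
    proof (intro AE_I2 tendsto_ennrealI tendsto_mult tendsto_power tendsto_const)
      fix t :: real
      \<comment> \<open>The limit of the multiplier is the derivative of z -> exp(-itz) at 0, whose
        modulus is |t|.\<close>
      have "((\<lambda>z. exp (- (\<i> * t) * z)) has_field_derivative - (\<i> * t)) (at 0)"
        by (auto intro!: derivative_eq_intros)
      then have "(\<lambda>z. (exp (- (\<i> * t) * z) - 1) / z) \<midarrow>0\<rightarrow> - (\<i> * t)"
        by (simp add: DERIV_def)
      moreover have "filterlim (\<lambda>j. complex_of_real (u j)) (at 0) sequentially"
        unfolding filterlim_at using u tendsto_of_real[OF u0, where 'a = complex] by (auto simp: less_imp_neq[THEN not_sym])
      ultimately have "(\<lambda>j. (exp (- (\<i> * t) * complex_of_real (u j)) - 1) / complex_of_real (u j)) \<longlonglongrightarrow> - (\<i> * t)"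
        by (rule filterlim_compose)
      from tendsto_norm[OF this] show "(\<lambda>j. cmod (cis (- (t * u j)) - 1) / u j) \<longlonglongrightarrow> \<bar>t\<bar>"
        using u by (simp add: norm_divide cis_conv_exp mult.assoc abs_of_pos norm_mult)
    qed
    show "(\<integral>\<^sup>+t. ennreal (?w j t) \<partial>lborel) \<le> ennreal (2 * pi) * (\<integral>\<^sup>+x. ennreal ((d x)\<^sup>2) \<partial>lborel)" for j
    proof -
      let ?D = "(fwd_diff (u j) ^^ k) (g 0)"
      have D: "integrable lborel ?D" using fourier_iterated_fwd_diff[OF g0] by simp
      note [measurable] = borel_measurable_fourier[OF D]
      have "(cmod (fourier ?D t))\<^sup>2 = cmod (cis (- (t * u j)) - 1) ^ (2 * k) * (cmod (fourier (g 0) t))\<^sup>2" for t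
        using fourier_iterated_fwd_diff[OF g0, where u = "u j" and m = k and t = t]
        by (simp add: norm_mult norm_power power_mult_distrib power_mult[symmetric] mult.commute)
      then have "?w j t = 1 / u j ^ (2 * k) * (cmod (fourier ?D t))\<^sup>2" for t
        by (simp add: power_divide)
      then have "(\<integral>\<^sup>+t. ennreal (?w j t) \<partial>lborel) = ennreal (1 / u j ^ (2 * k)) * (\<integral>\<^sup>+t. ennreal ((cmod (fourier ?D t))\<^sup>2) \<partial>lborel)"
        using u[of j] by (subst nn_integral_cmult[symmetric]) (auto simp flip: ennreal_mult')
      also have "\<dots> \<le> ennreal (1 / u j ^ (2 * k)) * (ennreal (2 * pi) * (ennreal (u j ^ (2 * k)) * (\<integral>\<^sup>+x. ennreal ((d x)\<^sup>2) \<partial>lborel)))"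
        using nn_integral_iterated_fwd_diff_le[where k = k and g = g and u = "u j" and i = 0 and m = k] prim u[of j] gk
        by (intro mult_left_mono order_trans[OF nn_integral_fourier_squared_le[OF D]]) auto
      also have "\<dots> = ennreal (1 / u j ^ (2 * k) * (2 * pi) * u j ^ (2 * k)) * (\<integral>\<^sup>+x. ennreal ((d x)\<^sup>2) \<partial>lborel)"
      proof -
        have "ennreal a * (ennreal b * (ennreal c * X)) = ennreal (a * b * c) * X" if "a \<ge> 0" "b \<ge> 0" "c \<ge> 0" for a b c X
          using that by (simp add: ennreal_mult mult.assoc)
        from this[of "1 / u j ^ (2 * k)" "2 * pi" "u j ^ (2 * k)"] show ?thesis
          using u[of j] by simp
      qed
      also have "1 / u j ^ (2 * k) * (2 * pi) * u j ^ (2 * k) = 2 * pi"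
        using u[of j] by simp
      finally show ?thesis .
    qed
  qed
qed

subsection \<open>Convergence rates\<close>

text \<open>The tail bound is split into \<open>b\<close>, which varies with \<open>n\<close>, and a
  fixed \<open>D\<close>. A rate \<open>c\<close> is then established as soon as c / (n h) and c * b
  stay bounded.\<close>

lemma Phi_le_tail:
  assumes K: "is_kernel K" and K2: "square_integrable K" and f: "is_density f"
    and n: "n \<ge> 1" and h: "h > 0" and D0: "D \<ge> 0" and b: "b \<ge> 0"
    and tail: "(\<integral>\<^sup>+t. ennreal ((cmod (fourier f t))\<^sup>2) * indicator {t. S_K K / h \<le> \<bar>t\<bar>} t \<partial>lborel) \<le> ennreal (b * D)"
    and c: "c \<ge> 0"
  shows "ennreal c * Phi n f K \<le> ennreal ((\<integral>x. (K x)\<^sup>2 \<partial>lborel) * (c / (real n * h))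
    + ((\<integral>x. \<bar>K x\<bar> \<partial>lborel) + 1)\<^sup>2 / (2 * pi) * D * (c * b))"
proof -
  let ?V = "\<integral>x. (K x)\<^sup>2 \<partial>lborel" and ?A = "((\<integral>x. \<bar>K x\<bar> \<partial>lborel) + 1)\<^sup>2 / (2 * pi)"
  have V: "?V \<ge> 0" by simp
  have "Phi n f K \<le> MISE n f K h" unfolding Phi_def using h by (intro INF_lower) simp
  also have "\<dots> \<le> ennreal (?V / (real n * h)) + ennreal ?A * ennreal (b * D)"
    using MISE_le[OF K K2 f n h] mult_left_mono[OF tail, of "ennreal ?A"] by (meson add_left_mono order_trans zero_le)
  also have "\<dots> = ennreal (?V / (real n * h) + ?A * (b * D))"
    using h n D0 b V by (simp flip: ennreal_mult' ennreal_plus)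
  finally have "ennreal c * Phi n f K \<le> ennreal c * ennreal (?V / (real n * h) + ?A * (b * D))"
    by (rule mult_left_mono) simp
  also have "\<dots> = ennreal (c * (?V / (real n * h) + ?A * (b * D)))"
    using c by (simp add: ennreal_mult')
  also have "c * (?V / (real n * h) + ?A * (b * D)) = ?V * (c / (real n * h)) + ?A * D * (c * b)"
    by (simp add: algebra_simps)
  finally show ?thesis .
qed

text \<open>Markov's inequality in weighted form: on \<open>T\<close> the factor
  \<open>b * w t\<close> can be inserted at no cost.\<close>

lemma nn_integral_tail_le:
  fixes F w :: "real \<Rightarrow> real"
  assumes [measurable]: "F \<in> borel_measurable borel" "w \<in> borel_measurable borel"
    and F: "\<And>t. F t \<ge> 0" and w: "\<And>t. w t \<ge> 0"
    and b: "b \<ge> 0" and tail: "\<And>t. t \<in> T \<Longrightarrow> 1 \<le> b * w t"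
    and D: "(\<integral>\<^sup>+t. ennreal (w t * F t) \<partial>lborel) = ennreal D"
  shows "(\<integral>\<^sup>+t. ennreal (F t) * indicator T t \<partial>lborel) \<le> ennreal (b * D)"
proof -
  have "(\<integral>\<^sup>+t. ennreal (F t) * indicator T t \<partial>lborel) \<le> (\<integral>\<^sup>+t. ennreal b * ennreal (w t * F t) \<partial>lborel)"
  proof (rule nn_integral_mono)
    fix t
    show "ennreal (F t) * indicator T t \<le> ennreal b * ennreal (w t * F t)"
    proof (cases "t \<in> T")
      case True
      have "F t \<le> b * w t * F t" using mult_right_mono[OF tail[OF True] F[of t]] by simp
      then show ?thesis using True b F w by (simp add: ennreal_leI mult.assoc flip: ennreal_mult')
    qed simp
  qed
  also have "\<dots> = ennreal b * ennreal D" by (subst nn_integral_cmult) (auto simp: D)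
  finally show ?thesis using b by (simp add: ennreal_mult')
qed

lemma Phi_smooth:
  assumes K: "is_kernel K" and K2: "square_integrable K" and SK: "S_K K > 0" and f: "is_density f"
    and k: "k \<ge> 1" and d: "has_kth_derivative k f d" and d2: "square_integrable d"
  shows "\<exists>C::real. \<forall>n::nat. n \<ge> 1 \<longrightarrow>
    ennreal (real n powr (2 * real k / (2 * real k + 1))) * Phi n f K \<le> ennreal C"
proof -
  have fint: "integrable lborel f" using f by (simp add: is_density_def)
  note [measurable] = borel_measurable_fourier[OF fint]
  define D where "D = enn2real (\<integral>\<^sup>+t. ennreal (\<bar>t\<bar> ^ (2 * k) * (cmod (fourier f t))\<^sup>2) \<partial>lborel)"
  have "(\<integral>\<^sup>+t. ennreal (\<bar>t\<bar> ^ (2 * k) * (cmod (fourier f t))\<^sup>2) \<partial>lborel) \<le> ennreal (2 * pi) * (\<integral>\<^sup>+x. ennreal ((d x)\<^sup>2) \<partial>lborel)"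
    by (rule nn_integral_fourier_kth_derivative_le[OF d fint k])
  \<comment> \<open>Square integrability of \<open>d\<close> makes the weighted integral finite, so
    \<open>enn2real\<close> loses nothing in \<open>D\<close>.\<close>
  also have "\<dots> < \<infinity>"
    using d2 by (simp add: square_integrable_def nn_integral_eq_integral ennreal_mult_less_top)
  finally have D: "(\<integral>\<^sup>+t. ennreal (\<bar>t\<bar> ^ (2 * k) * (cmod (fourier f t))\<^sup>2) \<partial>lborel) = ennreal D"
    by (simp add: D_def)
  have D0: "D \<ge> 0" by (simp add: D_def)
  let ?S = "S_K K" and ?p = "2 * real k + 1"
  let ?C = "(\<integral>x. (K x)\<^sup>2 \<partial>lborel) + ((\<integral>x. \<bar>K x\<bar> \<partial>lborel) + 1)\<^sup>2 / (2 * pi) * D * (1 / ?S ^ (2 * k))"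
  show ?thesis
  proof (intro exI[of _ ?C] allI impI)
    fix n :: nat assume n: "n \<ge> 1"
    define h where "h = real n powr (- 1 / ?p)"
    define c where "c = real n powr (2 * real k / ?p)"
    \<comment> \<open>On the tail |t| >= S/h one has 1 <= (h |t| / S)^(2k), so this is the factor
      paired with the weight |t|^(2k).\<close>
    define b where "b = (h / ?S) ^ (2 * k)"
    have h: "h > 0" using n by (simp add: h_def)
    have b: "b \<ge> 0" using h SK by (simp add: b_def)
    have ch: "c / (real n * h) = 1"
    proof -
      have "real n * h = real n powr 1 * real n powr (- 1 / ?p)" using n by (simp add: h_def)
      also have "\<dots> = real n powr (1 + - 1 / ?p)" by (rule powr_add[symmetric])
      also have "1 + - 1 / ?p = 2 * real k / ?p" by (simp add: field_simps)
      finally show ?thesis using n by (simp add: c_def)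
    qed
    have cb: "c * b = 1 / ?S ^ (2 * k)"
    proof -
      have "h ^ (2 * k) = h powr real (2 * k)" using h by (rule powr_realpow[symmetric])
      also have "\<dots> = real n powr (- (2 * real k / ?p))" by (simp add: h_def powr_powr field_simps)
      finally show ?thesis using n by (simp add: b_def c_def power_divide powr_minus)
    qed
    have "(\<integral>\<^sup>+t. ennreal ((cmod (fourier f t))\<^sup>2) * indicator {t. ?S / h \<le> \<bar>t\<bar>} t \<partial>lborel) \<le> ennreal (b * D)"
    proof (rule nn_integral_tail_le[OF _ _ _ _ b _ D])
      fix t assume "t \<in> {t. ?S / h \<le> \<bar>t\<bar>}"
      then have "1 \<le> h / ?S * \<bar>t\<bar>" using h SK by (simp add: field_simps)
      from one_le_power[OF this] show "1 \<le> b * \<bar>t\<bar> ^ (2 * k)" by (simp add: b_def power_mult_distrib power_divide)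
    qed auto
    from Phi_le_tail[OF K K2 f n h D0 b this, of c]
    show "ennreal (real n powr (2 * real k / ?p)) * Phi n f K \<le> ennreal ?C"
      by (simp add: ch cb flip: c_def) (simp add: c_def)
  qed
qed

lemma Phi_supersmooth:
  assumes K: "is_kernel K" and K2: "square_integrable K" and SK: "S_K K > 0" and f: "is_density f"
    and \<alpha>: "\<alpha> > 0" and \<gamma>: "\<gamma> > 0"
    and fin: "(\<integral>\<^sup>+ t. ennreal (exp (\<gamma> * \<bar>t\<bar> powr \<alpha>) * (cmod (fourier f t))\<^sup>2) \<partial>lborel) < \<infinity>"
  shows "\<exists>C::real. \<forall>n::nat. n \<ge> 2 \<longrightarrow>
    ennreal (real n / ln (real n) powr (1 / \<alpha>)) * Phi n f K \<le> ennreal C"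
proof -
  have fint: "integrable lborel f" using f by (simp add: is_density_def)
  note [measurable] = borel_measurable_fourier[OF fint]
  define D where "D = enn2real (\<integral>\<^sup>+ t. ennreal (exp (\<gamma> * \<bar>t\<bar> powr \<alpha>) * (cmod (fourier f t))\<^sup>2) \<partial>lborel)"
  have D: "(\<integral>\<^sup>+ t. ennreal (exp (\<gamma> * \<bar>t\<bar> powr \<alpha>) * (cmod (fourier f t))\<^sup>2) \<partial>lborel) = ennreal D"
    using fin by (simp add: D_def)
  have D0: "D \<ge> 0" by (simp add: D_def)
  let ?S = "S_K K" and ?V = "\<integral>x. (K x)\<^sup>2 \<partial>lborel" and ?A = "((\<integral>x. \<bar>K x\<bar> \<partial>lborel) + 1)\<^sup>2 / (2 * pi)"
  let ?C = "?V * (1 / (?S * \<gamma> powr (1 / \<alpha>))) + ?A * D * (1 / ln 2 powr (1 / \<alpha>))"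
  show ?thesis
  proof (intro exI[of _ ?C] allI impI)
    fix n :: nat assume n: "n \<ge> 2"
    have ln: "ln (real n) > 0" "ln 2 \<le> ln (real n)" using n by auto
    define c where "c = real n / ln (real n) powr (1 / \<alpha>)"
    \<comment> \<open>Then S/h = (ln n / gamma)^(1/alpha), the frequency from which on the weight
      exp(gamma |t|^alpha) is at least \<open>n\<close>.\<close>
    define h where "h = ?S * (\<gamma> / ln (real n)) powr (1 / \<alpha>)"
    have h: "h > 0" using SK \<gamma> ln by (simp add: h_def)
    have c0: "c \<ge> 0" by (simp add: c_def)
    have ch: "c / (real n * h) = 1 / (?S * \<gamma> powr (1 / \<alpha>))"
      using n ln \<gamma> SK by (simp add: c_def h_def powr_divide)
    \<comment> \<open>The rescaled bias is (ln n)^(-1/alpha) up to constants, largest at n =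
      2.\<close>
    have cb: "c * (1 / real n) \<le> 1 / ln 2 powr (1 / \<alpha>)"
      using n ln \<alpha> by (auto simp: c_def intro!: divide_left_mono powr_mono2)
    have "(\<integral>\<^sup>+t. ennreal ((cmod (fourier f t))\<^sup>2) * indicator {t. ?S / h \<le> \<bar>t\<bar>} t \<partial>lborel) \<le> ennreal (1 / real n * D)"
    proof (rule nn_integral_tail_le[OF _ _ _ _ _ _ D])
      fix t assume t: "t \<in> {t. ?S / h \<le> \<bar>t\<bar>}"
      have "?S / h = (ln (real n) / \<gamma>) powr (1 / \<alpha>)"
        using SK ln \<gamma> by (simp add: h_def powr_divide)
      then have "(ln (real n) / \<gamma>) powr (1 / \<alpha>) \<le> \<bar>t\<bar>" using t by simp
      then have "((ln (real n) / \<gamma>) powr (1 / \<alpha>)) powr \<alpha> \<le> \<bar>t\<bar> powr \<alpha>"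
        using \<alpha> by (intro powr_mono2) auto
      then have "ln (real n) / \<gamma> \<le> \<bar>t\<bar> powr \<alpha>" using \<alpha> \<gamma> ln by (simp add: powr_powr)
      then have "ln (real n) \<le> \<gamma> * \<bar>t\<bar> powr \<alpha>" using \<gamma> by (simp add: field_simps)
      then have "exp (ln (real n)) \<le> exp (\<gamma> * \<bar>t\<bar> powr \<alpha>)" by simp
      then have "real n \<le> exp (\<gamma> * \<bar>t\<bar> powr \<alpha>)" using n by simp
      then show "1 \<le> 1 / real n * exp (\<gamma> * \<bar>t\<bar> powr \<alpha>)" using n by (simp add: field_simps)
    qed auto
    from Phi_le_tail[OF K K2 f _ h D0 _ this c0, of n]
    have "ennreal c * Phi n f K \<le> ennreal (?V * (1 / (?S * \<gamma> powr (1 / \<alpha>))) + ?A * D * (c * (1 / real n)))"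
      using n by (simp only: ch) simp
    also have "\<dots> \<le> ennreal ?C"
      using D0 by (intro ennreal_leI add_left_mono mult_left_mono cb) auto
    finally show "ennreal (real n / ln (real n) powr (1 / \<alpha>)) * Phi n f K \<le> ennreal ?C" by (simp only: c_def)
  qed
qed

theorem theorem5:
  fixes K f :: "real \<Rightarrow> real"
  assumes K: "is_kernel K" and K2: "square_integrable K" and SK: "S_K K > 0"
    and f: "is_density f" and f2: "square_integrable f"
  shows "(\<forall>k::nat. \<forall>d. k \<ge> 1 \<longrightarrow> has_kth_derivative k f d \<longrightarrow> integrable lborel d
            \<longrightarrow> square_integrable d \<longrightarrow>
          (\<exists>C::real. \<forall>n::nat. n \<ge> 1 \<longrightarrow>
             ennreal (real n powr (2 * real k / (2 * real k + 1))) * Phi n f K \<le> ennreal C))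
       \<and> (\<forall>\<alpha> \<gamma>::real. \<alpha> > 0 \<longrightarrow> \<gamma> > 0 \<longrightarrow>
          (\<integral>\<^sup>+ t. ennreal (exp (\<gamma> * \<bar>t\<bar> powr \<alpha>) * (cmod (fourier f t))\<^sup>2) \<partial>lborel) < \<infinity> \<longrightarrow>
          (\<exists>C::real. \<forall>n::nat. n \<ge> 2 \<longrightarrow>
             ennreal (real n / ln (real n) powr (1 / \<alpha>)) * Phi n f K \<le> ennreal C))"
  using Phi_smooth[OF K K2 SK f] Phi_supersmooth[OF K K2 SK f] by blast

end
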